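(* Let $n\ge 3$ be an odd natural number, let $d,R\in\mathbb{Q}$ with $d\neq 0$ and $R$ not a square in $\mathbb{Q}$, and put $D=d^2-R$. Write $R=s^2R'$ with $s\in\mathbb{Q}$ and $R'\in\mathbb{Z}$ square-free. Let $L\subseteq\mathbb{C}$ be the splitting field over $\mathbb{Q}$ of $f_n=f_n(Z,d,R)$, and let $\zeta_n$ be a primitive $n$th root of unity. Suppose that $f_n$ is irreducible in $\mathbb{Q}[Z]$, and that $R'\neq -3$ if $3\mid n$. Then $\mathrm{Gal}(L/\mathbb{Q})$ is isomorphic to a semidirect product $$(\mathbb{Z}/n\mathbb{Z})\rtimes(\mathbb{Z}/n\mathbb{Z})^{\times},$$ except in the case $R'<0$ and $\sqrt{R'}\in\mathbb{Q}(\zeta_n)$, where $\mathrm{Gal}(L/\mathbb{Q})$ is isomorphic to a semidirect product $$(\mathbb{Z}/n\mathbb{Z})\rtimes\big((\mathbb{Z}/n\mathbb{Z})^{\times}/\{\pm1\}\big).$$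
   Context: For an integer $k\ge 1$ let $F_k\in\mathbb{Z}[Z]$ be the polynomial $F_k=\sum_{j=0}^{\lfloor k/2\rfloor}(-1)^j\frac{k}{k-j}\binom{k-j}{j}Z^{k-2j}$, i.e. $F_k(Z)=2T_k(Z/2)$ with $T_k$ the Chebyshev polynomial of the first kind; equivalently $2\cos(kx)=F_k(2\cos x)$ and $F_k(W+W^{-1})=W^k+W^{-k}$. For odd $n\ge3$, $d,R\in\mathbb{Q}$, $d\ne0$, $R$ not a square, $D=d^2-R$, the De Moivre polynomial is $$f_n(Z,d,R)=\sqrt D^{\,n}F_n(Z/\sqrt D)-2dD^{(n-1)/2}=\sum_{j=0}^{(n-1)/2}(-1)^j\frac{n}{n-j}\binom{n-j}{j}D^jZ^{n-2j}-2dD^{(n-1)/2}\in\mathbb{Q}[Z].$$ (If $y^n=d+\sqrt R$, $y'^n=d-\sqrt R$ and $z=yy'$, then $u=z^{(n-1)/2}(y+y')$ is a zero of $f_n$.) *)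

theory Defs
  imports "HOL-Algebra.Elementary_Groups" "HOL-Number_Theory.Residues"
    "HOL-Computational_Algebra.Polynomial" "HOL-Computational_Algebra.Squarefree"
    Complex_Main
begin

definition de_moivre_poly :: "nat \<Rightarrow> rat \<Rightarrow> rat \<Rightarrow> rat poly" where
  "de_moivre_poly n d R =
     (let D = d^2 - R in
      (\<Sum>j\<le>(n - 1) div 2.
          monom ((-1)^j * (of_nat n / of_nat (n - j)) * of_nat ((n - j) choose j) * D^j) (n - 2*j))
      - [: 2 * d * D ^ ((n - 1) div 2) :])"

definition is_subfield :: "complex set \<Rightarrow> bool" where
  "is_subfield K \<longleftrightarrow> 0 \<in> K \<and> 1 \<in> K \<and>
     (\<forall>x\<in>K. \<forall>y\<in>K. x + y \<in> K \<and> x * y \<in> K) \<and>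
     (\<forall>x\<in>K. - x \<in> K) \<and> (\<forall>x\<in>K. x \<noteq> 0 \<longrightarrow> inverse x \<in> K)"

definition gen_field :: "complex set \<Rightarrow> complex set" where
  "gen_field S = \<Inter>{K. is_subfield K \<and> S \<subseteq> K}"

definition splitting_field :: "rat poly \<Rightarrow> complex set" where
  "splitting_field f = gen_field {z. poly (map_poly of_rat f) z = 0}"

text \<open>Galois group Gal(L/Q) of a subfield L of C: all field automorphisms of L
  (these automatically fix Q), represented as maps that are the identity outside L,
  with composition as the group operation.\<close>
definition field_auts :: "complex set \<Rightarrow> (complex \<Rightarrow> complex) set" where
  "field_auts L = {\<sigma>. bij_betw \<sigma> L L \<and>
      (\<forall>x\<in>L. \<forall>y\<in>L. \<sigma> (x + y) = \<sigma> x + \<sigma> y \<and> \<sigma> (x * y) = \<sigma> x * \<sigma> y) \<and>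
      \<sigma> 1 = 1 \<and> (\<forall>x. x \<notin> L \<longrightarrow> \<sigma> x = x)}"

definition Gal :: "complex set \<Rightarrow> (complex \<Rightarrow> complex) monoid" where
  "Gal L = \<lparr>carrier = field_auts L, monoid.mult = (\<lambda>\<sigma> \<tau>. \<sigma> \<circ> \<tau>), one = id\<rparr>"

definition aut_action :: "('n, 'a) monoid_scheme \<Rightarrow> ('h, 'b) monoid_scheme \<Rightarrow> ('h \<Rightarrow> 'n \<Rightarrow> 'n) \<Rightarrow> bool" where
  "aut_action N H \<phi> \<longleftrightarrow>
     (\<forall>h\<in>carrier H. \<phi> h \<in> iso N N) \<and>
     (\<forall>h1\<in>carrier H. \<forall>h2\<in>carrier H. \<forall>a\<in>carrier N.
        \<phi> (h1 \<otimes>\<^bsub>H\<^esub> h2) a = \<phi> h1 (\<phi> h2 a))"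

definition semidirect_product :: "('n, 'a) monoid_scheme \<Rightarrow> ('h, 'b) monoid_scheme \<Rightarrow> ('h \<Rightarrow> 'n \<Rightarrow> 'n) \<Rightarrow> ('n \<times> 'h) monoid" where
  "semidirect_product N H \<phi> =
     \<lparr>carrier = carrier N \<times> carrier H,
      monoid.mult = (\<lambda>(a, x) (b, y). (a \<otimes>\<^bsub>N\<^esub> \<phi> x b, x \<otimes>\<^bsub>H\<^esub> y)),
      one = (\<one>\<^bsub>N\<^esub>, \<one>\<^bsub>H\<^esub>)\<rparr>"

definition iso_semidirect :: "('g, 'c) monoid_scheme \<Rightarrow> ('n, 'a) monoid_scheme \<Rightarrow> ('h, 'b) monoid_scheme \<Rightarrow> bool" where
  "iso_semidirect G N H \<longleftrightarrow> (\<exists>\<phi>. aut_action N H \<phi> \<and> G \<cong> semidirect_product N H \<phi>)"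

definition units_mod :: "nat \<Rightarrow> int monoid" where
  "units_mod n = units_of (residue_ring (int n))"

definition units_mod_pm :: "nat \<Rightarrow> int set monoid" where
  "units_mod_pm n = units_mod n Mod {1, int n - 1}"

end

theory Submission
  imports Defs "HOL-Computational_Algebra.Fundamental_Theorem_Algebra"
    "HOL-Computational_Algebra.Polynomial_Factorial" "HOL-Computational_Algebra.Field_as_Ring"
begin

text \<open>
  Write \<open>t t' = D\<close> with \<open>t^n = D^((n-1)/2) (d + sqrt R)\<close>; the roots are \<open>u_j = \<zeta>^j t + \<zeta>^(-j) t'\<close>
  for \<open>j\<close> modulo \<open>n\<close>, and every automorphism acts on the indices by an affine map \<open>j \<mapsto> b + a j\<close>.
  It sends \<open>c_j = \<zeta>^j + \<zeta>^(-j)\<close> to \<open>c_(aj)\<close> and \<open>e_j = (\<zeta>^j - \<zeta>^(-j)) sqrt R\<close> to \<open>e_(aj)\<close>.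
  Irreducibility of \<open>f_n\<close> makes the action transitive, and irreducibility of the cyclotomic polynomial
  realises every unit \<open>a\<close> up to sign. If all translations in the group were divisible by a prime \<open>p | n\<close>,
  commutators would force \<open>a = 1\<close> modulo \<open>p\<close> for all group elements; taking \<open>a = 2\<close> up to sign gives
  \<open>p = 3\<close>, and then \<open>e_(n/3)\<close>, which is \<open>sqrt (-3 R)\<close>, is rational, that is \<open>R' = -3\<close>. So all translations
  occur, and the group is \<open>Z/n\<close> extended by the set \<open>H\<close> of multipliers \<open>a\<close>. The multiplier \<open>-1\<close> fixes
  \<open>Q(c_1)\<close> and negates \<open>e_1\<close>, so it occurs iff \<open>e_1\<close> is not in \<open>Q(c_1)\<close>, which is the non-exceptional case.
  Hence \<open>H\<close> consists of all units, or is a complement of \<open>{1, -1}\<close>.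
\<close>

section \<open>Extending embeddings of subfields of the complex numbers\<close>

text \<open>In general none of \<open>\<zeta>\<close>, \<open>\<rho> = sqrt R\<close> and
  \<open>t\<close> need lie in the splitting field: exchanging \<open>t\<close> with
  \<open>t'\<close>, \<open>\<zeta>\<close> with its inverse and \<open>\<rho>\<close> with
  \<open>-\<rho>\<close> leaves every root unchanged. So an automorphism cannot be followed on these
  generators. The proof works with quantities invariant under the exchange: the roots, the
  \<open>c_j\<close>, and the \<open>e_j\<close>, in which two sign changes cancel. All are rational
  expressions in the roots, so an affine action on indices determines their images. The same
  symmetry explains the ambiguity of sign: \<open>c_a = c_(-a)\<close>, so conjugates of
  \<open>c_1\<close> see a multiplier only up to sign, and \<open>e_1\<close> has to decide it.
  Translations are reached indirectly because irreducibility yields an automorphism taking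
  \<open>u_0\<close> to \<open>u_b\<close> but says nothing about its multiplier; commutators always
  have multiplier 1. The prime 3 is special because 2 is congruent to 1 or -1 modulo a prime only
  for the prime 3. Once all translations are present, the stabiliser of \<open>u_0\<close> is a
  complement to them, so the extension splits.\<close>

definition poly_over :: "complex set \<Rightarrow> complex poly \<Rightarrow> bool" where
  "poly_over K p \<longleftrightarrow> (\<forall>i. coeff p i \<in> K)"

definition hom_on :: "complex set \<Rightarrow> (complex \<Rightarrow> complex) \<Rightarrow> bool" where
  "hom_on K \<tau> \<longleftrightarrow> (\<forall>x\<in>K. \<forall>y\<in>K. \<tau> (x + y) = \<tau> x + \<tau> y \<and> \<tau> (x * y) = \<tau> x * \<tau> y) \<and> \<tau> 1 = 1"

definition alg_over :: "complex set \<Rightarrow> complex \<Rightarrow> bool" where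
  "alg_over K a \<longleftrightarrow> (\<exists>p. poly_over K p \<and> p \<noteq> 0 \<and> poly p a = 0)"

section \<open>Subfields, polynomials over them, and simple extensions\<close>

context
  fixes K assumes K: "is_subfield K"
begin

lemma subfield_0: "0 \<in> K" and subfield_1: "1 \<in> K"
  and subfield_add: "x \<in> K \<Longrightarrow> y \<in> K \<Longrightarrow> x + y \<in> K"
  and subfield_mult: "x \<in> K \<Longrightarrow> y \<in> K \<Longrightarrow> x * y \<in> K"
  and subfield_uminus: "x \<in> K \<Longrightarrow> - x \<in> K"
  using K by (auto simp: is_subfield_def)

lemma subfield_diff: "x \<in> K \<Longrightarrow> y \<in> K \<Longrightarrow> x - y \<in> K"
  using subfield_add[of x "-y"] subfield_uminus[of y] by simp

lemma subfield_inverse: "x \<in> K \<Longrightarrow> inverse x \<in> K"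
  using K by (cases "x = 0") (auto simp: is_subfield_def)

lemma subfield_divide: "x \<in> K \<Longrightarrow> y \<in> K \<Longrightarrow> x / y \<in> K"
  by (simp add: divide_inverse subfield_mult subfield_inverse)

lemma subfield_power: "x \<in> K \<Longrightarrow> x ^ n \<in> K"
  by (induction n) (auto intro: subfield_1 subfield_mult)

lemma subfield_sum: "(\<And>i. i \<in> A \<Longrightarrow> f i \<in> K) \<Longrightarrow> sum f A \<in> K"
  by (induction A rule: infinite_finite_induct) (auto intro: subfield_0 subfield_add)

lemma subfield_of_nat: "of_nat n \<in> K"
  by (induction n) (auto intro: subfield_0 subfield_1 subfield_add)

lemma subfield_of_int: "of_int n \<in> K"
  by (cases n rule: int_cases2) (auto intro: subfield_of_nat subfield_uminus)

lemma subfield_of_rat: "of_rat q \<in> K"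
proof -
  obtain a b where "q = of_int a / of_int b" by (metis Fract_of_int_quotient Rat_cases)
  then show ?thesis by (simp add: of_rat_divide subfield_divide subfield_of_int)
qed

lemma Rats_subset_subfield: "\<rat> \<subseteq> K"
  by (auto simp: Rats_def subfield_of_rat)

lemma poly_over_0: "poly_over K 0"
  and poly_over_add: "poly_over K p \<Longrightarrow> poly_over K q \<Longrightarrow> poly_over K (p + q)"
  and poly_over_diff: "poly_over K p \<Longrightarrow> poly_over K q \<Longrightarrow> poly_over K (p - q)"
  and poly_over_uminus: "poly_over K p \<Longrightarrow> poly_over K (- p)"
  and poly_over_monom: "c \<in> K \<Longrightarrow> poly_over K (monom c n)"
  by (auto simp: poly_over_def subfield_0 subfield_add subfield_diff subfield_uminus)

lemma poly_over_mult: "poly_over K p \<Longrightarrow> poly_over K q \<Longrightarrow> poly_over K (p * q)"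
  by (auto simp: poly_over_def coeff_mult intro!: subfield_sum subfield_mult)

lemma poly_over_pCons: "poly_over K (pCons c p) \<longleftrightarrow> c \<in> K \<and> poly_over K p"
  unfolding poly_over_def by (metis coeff_pCons_0 coeff_pCons_Suc not0_implies_Suc)

lemma poly_in_subfield: "poly_over K p \<Longrightarrow> x \<in> K \<Longrightarrow> poly p x \<in> K"
  by (induction p) (auto simp: poly_over_pCons subfield_0 intro: subfield_add subfield_mult)

text \<open>The subfield is a set and not a type, so long division has to be seen to stay over
  \<open>K\<close>: each step divides two leading coefficients, both in \<open>K\<close>.\<close>

lemma poly_over_division:
  assumes "poly_over K m" "m \<noteq> 0" "poly_over K p"
  shows "\<exists>q r. poly_over K q \<and> poly_over K r \<and> p = m * q + r \<and> (r = 0 \<or> degree r < degree m)"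
  using assms(3)
\<comment> \<open>The measure ranks 0 below the nonzero constants; the degree alone would not drop
  when a constant is reduced to 0.\<close>
proof (induction "if p = 0 then 0 else Suc (degree p)" arbitrary: p rule: less_induct)
  case less
  show ?case
  proof (cases "p = 0 \<or> degree p < degree m")
    case True
    then show ?thesis using less.prems poly_over_0 by (intro exI[of _ 0] exI[of _ p]) auto
  next
    case False
    define c where "c = monom (lead_coeff p / lead_coeff m) (degree p - degree m)"
    have c: "poly_over K c"
      using less.prems assms(1) by (auto simp: c_def poly_over_def intro!: subfield_divide subfield_0)
    have c0: "c \<noteq> 0" using False assms(2) by (simp add: c_def)
    define p' where "p' = p - m * c"
    have p': "poly_over K p'"
      unfolding p'_def by (intro poly_over_diff poly_over_mult less.prems assms(1) c)
    have dc: "degree (m * c) = degree p"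
      using False assms(2) c0 by (simp add: degree_mult_eq c_def degree_monom_eq)
    have lc: "lead_coeff (m * c) = lead_coeff p"
      using False assms(2) by (simp add: lead_coeff_mult) (simp add: c_def degree_monom_eq)
    have "p' = 0 \<or> degree p' < degree p"
    proof (cases "degree p = 0")
      case True
      then obtain x y where "p = [:x:]" "m * c = [:y:]" using dc by (metis degree_eq_zeroE)
      then show ?thesis using lc by (simp add: p'_def)
    next
      case F: False
      have "coeff p' (degree p) = 0" using dc lc by (simp add: p'_def)
      moreover have "degree p' \<le> degree p" unfolding p'_def using dc by (intro degree_diff_le) auto
      ultimately show ?thesis using F by (metis leading_coeff_0_iff nat_less_le)
    qed
    then have "(if p' = 0 then 0 else Suc (degree p')) < (if p = 0 then 0 else Suc (degree p))"
      using False by auto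
    from less.hyps[OF this p'] obtain q r where *: "poly_over K q" "poly_over K r" "p' = m * q + r"
        "r = 0 \<or> degree r < degree m" by blast
    then have "p = m * (q + c) + r" by (simp add: p'_def algebra_simps)
    then show ?thesis using * c poly_over_add by blast
  qed
qed

text \<open>\<open>m\<close> has least degree among the nonzero polynomials over \<open>K\<close>
  that vanish at \<open>a\<close>; the remainder of any other such polynomial vanishes at
  \<open>a\<close> too and is 0 by minimality.\<close>

lemma minimal_poly_exists:
  assumes "alg_over K a"
  obtains m where "poly_over K m" "m \<noteq> 0" "poly m a = 0" "degree m > 0"
    "\<And>p. poly_over K p \<Longrightarrow> poly p a = 0 \<Longrightarrow> \<exists>q. poly_over K q \<and> p = m * q"
    "\<And>p. poly_over K p \<Longrightarrow> poly p a = 0 \<Longrightarrow> p \<noteq> 0 \<Longrightarrow> degree m \<le> degree p"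
proof -
  define P where "P = (\<lambda>p. poly_over K p \<and> p \<noteq> 0 \<and> poly p a = 0)"
  have "\<exists>p. P p" using assms by (simp add: alg_over_def P_def)
  then obtain m where m: "P m" "\<And>p. P p \<Longrightarrow> degree m \<le> degree p"
    using ex_has_least_nat[of P _ degree] by blast
  have "degree m > 0"
  proof (rule ccontr)
    assume "\<not> ?thesis"
    then obtain x where "m = [:x:]" by (metis degree_eq_zeroE not_gr0)
    then show False using m(1) by (simp add: P_def)
  qed
  moreover have "\<exists>q. poly_over K q \<and> p = m * q" if p: "poly_over K p" "poly p a = 0" for p
  proof -
    obtain q r where *: "poly_over K q" "poly_over K r" "p = m * q + r" "r = 0 \<or> degree r < degree m"
      using poly_over_division p m(1) unfolding P_def by metis
    have "poly r a = 0" using * p m(1) by (simp add: P_def)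
    then have "r = 0" using m(2)[of r] *(2,4) unfolding P_def by force
    then show ?thesis using * by auto
  qed
  ultimately show thesis using that m unfolding P_def by blast
qed

text \<open>Only inverses need an argument. From \<open>m = p * q + r\<close> one gets
  \<open>p(a) * q(a) = - r(a)\<close>, so inverting \<open>p(a)\<close> reduces to inverting
  \<open>r(a)\<close>, where \<open>r\<close> has smaller degree.\<close>

lemma subfield_adjoin:
  assumes "alg_over K a"
  shows "is_subfield {poly p a | p. poly_over K p}"
proof -
  obtain m where m: "poly_over K m" "m \<noteq> 0" "poly m a = 0" "degree m > 0"
    "\<And>p. poly_over K p \<Longrightarrow> poly p a = 0 \<Longrightarrow> \<exists>q. poly_over K q \<and> p = m * q"
    "\<And>p. poly_over K p \<Longrightarrow> poly p a = 0 \<Longrightarrow> p \<noteq> 0 \<Longrightarrow> degree m \<le> degree p"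
    using minimal_poly_exists[OF assms] by blast
  have inv0: "\<exists>q. poly_over K q \<and> poly q a = inverse (poly p a)"
    if "poly_over K p" "poly p a \<noteq> 0" "degree p < degree m" for p
    using that
  proof (induction "degree p" arbitrary: p rule: less_induct)
    case less
    show ?case
    proof (cases "degree p = 0")
      case True
      then obtain x where x: "p = [:x:]" by (metis degree_eq_zeroE)
      then have "x \<in> K" using less.prems poly_over_pCons by auto
      then show ?thesis using x subfield_inverse
        by (intro exI[of _ "[:inverse x:]"]) (auto simp: poly_over_pCons poly_over_0)
    next
      case False
      then have "p \<noteq> 0" by auto
      then obtain q r where *: "poly_over K q" "poly_over K r" "m = p * q + r" "r = 0 \<or> degree r < degree p"
        using poly_over_division less.prems(1) m(1) by metis
      have eq: "poly p a * poly q a = - poly r a" using m(3) * by (simp add: add_eq_0_iff2)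
      \<comment> \<open>Were \<open>r(a)\<close> zero, minimality would give \<open>r = 0\<close>
        and \<open>m = p * q\<close>; then \<open>q\<close> vanishes at \<open>a\<close> with degree
        below that of \<open>m\<close>.\<close>
      have ra: "poly r a \<noteq> 0"
      proof
        assume r: "poly r a = 0"
        have "r = 0"
          using m(6)[OF *(2) r] *(4) less.prems(3) by force
        then have "m = p * q" using * by simp
        then have "degree m = degree p + degree q" "q \<noteq> 0" using m(2) degree_mult_eq by auto
        moreover have "poly q a = 0" using eq r less.prems by simp
        ultimately show False using m(6)[OF *(1)] False by auto
      qed
      then have "degree r < degree p" using * by auto
      then obtain s where s: "poly_over K s" "poly s a = inverse (poly r a)"
        using less.hyps[of r] *(2) ra less.prems(3) by auto
      have "poly (- (q * s)) a = inverse (poly p a)"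
      proof -
        have "poly p a * (- (poly q a * poly s a)) = 1"
          using eq s ra by (simp add: mult.assoc[symmetric])
        then show ?thesis using inverse_unique by fastforce
      qed
      then show ?thesis using s * poly_over_mult poly_over_uminus by blast
    qed
  qed
  have "\<exists>q. poly_over K q \<and> poly q a = inverse (poly p a)" if p: "poly_over K p" "poly p a \<noteq> 0" for p
  proof -
    obtain q r where *: "poly_over K q" "poly_over K r" "p = m * q + r" "r = 0 \<or> degree r < degree m"
      using poly_over_division[OF m(1,2) p(1)] by metis
    have "poly p a = poly r a" using * m(3) by simp
    then show ?thesis using inv0[OF *(2)] p m(4) *(4) by (metis degree_0)
  qed
  then show ?thesis
    unfolding is_subfield_def
    apply (intro conjI ballI impI)
    subgoal using poly_over_0 by force
    subgoal by (rule CollectI, rule exI[of _ "[:1:]"]) (simp add: poly_over_pCons poly_over_0 subfield_1)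
    subgoal by clarify (metis poly_add poly_over_add)
    subgoal by clarify (metis poly_mult poly_over_mult)
    subgoal by clarify (metis poly_minus poly_over_uminus)
    subgoal by clarify metis
    done
qed

section \<open>Homomorphisms on a subfield and their extensions\<close>

lemma hom_on_add: "hom_on K \<tau> \<Longrightarrow> x \<in> K \<Longrightarrow> y \<in> K \<Longrightarrow> \<tau> (x + y) = \<tau> x + \<tau> y"
  and hom_on_mult: "hom_on K \<tau> \<Longrightarrow> x \<in> K \<Longrightarrow> y \<in> K \<Longrightarrow> \<tau> (x * y) = \<tau> x * \<tau> y"
  and hom_on_1: "hom_on K \<tau> \<Longrightarrow> \<tau> 1 = 1"
  by (auto simp: hom_on_def)

lemma hom_on_0: "hom_on K \<tau> \<Longrightarrow> \<tau> 0 = 0"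
  using hom_on_add[of \<tau> 0 0] subfield_0 by simp

lemma hom_on_uminus: "hom_on K \<tau> \<Longrightarrow> x \<in> K \<Longrightarrow> \<tau> (- x) = - \<tau> x"
  using hom_on_add[of \<tau> x "-x"] subfield_uminus[of x] hom_on_0[of \<tau>] by (simp add: eq_neg_iff_add_eq_0 add.commute)

lemma hom_on_diff: "hom_on K \<tau> \<Longrightarrow> x \<in> K \<Longrightarrow> y \<in> K \<Longrightarrow> \<tau> (x - y) = \<tau> x - \<tau> y"
  using hom_on_add[of \<tau> x "-y"] hom_on_uminus[of \<tau> y] subfield_uminus[of y] by simp

lemma hom_on_eq_0_iff: "hom_on K \<tau> \<Longrightarrow> x \<in> K \<Longrightarrow> \<tau> x = 0 \<longleftrightarrow> x = 0"
  using hom_on_mult[of \<tau> x "inverse x"] subfield_inverse[of x] hom_on_0 hom_on_1[of \<tau>] by (cases "x = 0") auto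

lemma hom_on_inj: "hom_on K \<tau> \<Longrightarrow> inj_on \<tau> K"
  by (rule inj_onI) (metis eq_iff_diff_eq_0 hom_on_diff hom_on_eq_0_iff subfield_diff)

lemma hom_on_inverse: "hom_on K \<tau> \<Longrightarrow> x \<in> K \<Longrightarrow> \<tau> (inverse x) = inverse (\<tau> x)"
  using hom_on_mult[of \<tau> x "inverse x"] subfield_inverse[of x] hom_on_0[of \<tau>] hom_on_1[of \<tau>] hom_on_eq_0_iff[of \<tau> x]
  by (cases "x = 0") (auto simp: inverse_unique)

lemma hom_on_divide: "hom_on K \<tau> \<Longrightarrow> x \<in> K \<Longrightarrow> y \<in> K \<Longrightarrow> \<tau> (x / y) = \<tau> x / \<tau> y"
  by (simp add: divide_inverse hom_on_mult hom_on_inverse subfield_inverse)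

lemma hom_on_of_nat: "hom_on K \<tau> \<Longrightarrow> \<tau> (of_nat n) = of_nat n"
  by (induction n) (auto simp: hom_on_0 hom_on_1 hom_on_add subfield_1 subfield_of_nat)

lemma hom_on_of_int: "hom_on K \<tau> \<Longrightarrow> \<tau> (of_int n) = of_int n"
  by (cases n rule: int_cases2) (auto simp: hom_on_of_nat hom_on_uminus subfield_of_nat)

lemma hom_on_of_rat: "hom_on K \<tau> \<Longrightarrow> \<tau> (of_rat q) = of_rat q"
proof -
  assume *: "hom_on K \<tau>"
  obtain a b where "q = of_int a / of_int b" by (metis Fract_of_int_quotient Rat_cases)
  then show ?thesis using * by (simp add: of_rat_divide hom_on_divide subfield_of_int hom_on_of_int)
qed

lemma hom_on_sum: "hom_on K \<tau> \<Longrightarrow> (\<And>i. i \<in> A \<Longrightarrow> f i \<in> K) \<Longrightarrow> \<tau> (sum f A) = (\<Sum>i\<in>A. \<tau> (f i))"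
  by (induction A rule: infinite_finite_induct) (auto simp: hom_on_0 hom_on_add subfield_sum)

lemma hom_on_poly:
  assumes "hom_on K \<tau>" "poly_over K p" "x \<in> K"
  shows "\<tau> (poly p x) = poly (map_poly \<tau> p) (\<tau> x)"
  using assms(2)
  by (induction p)
    (auto simp: poly_over_pCons hom_on_0 hom_on_add hom_on_mult assms poly_in_subfield subfield_mult map_poly_pCons)

lemma map_poly_hom_on:
  assumes "hom_on K \<tau>" "poly_over K p" "poly_over K q"
  shows "map_poly \<tau> (p * q) = map_poly \<tau> p * map_poly \<tau> q"
    and "map_poly \<tau> (p + q) = map_poly \<tau> p + map_poly \<tau> q"
    and "map_poly \<tau> (p - q) = map_poly \<tau> p - map_poly \<tau> q"
  using assms(2,3)
  by (auto intro!: poly_eqI sum.cong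
        simp: poly_over_def coeff_map_poly coeff_mult hom_on_0 hom_on_add hom_on_diff hom_on_sum hom_on_mult subfield_mult assms(1))

text \<open>The value at \<open>poly p a\<close> must be the transported polynomial at
  \<open>b\<close>; the second assumption is exactly what makes this independent of the chosen
  \<open>p\<close>.\<close>

lemma hom_extend_simple:
  assumes \<tau>: "hom_on K \<tau>" and b: "\<And>p. poly_over K p \<Longrightarrow> poly p a = 0 \<Longrightarrow> poly (map_poly \<tau> p) b = 0"
  shows "\<exists>\<tau>'. hom_on {poly p a | p. poly_over K p} \<tau>' \<and> (\<forall>x\<in>K. \<tau>' x = \<tau> x) \<and> \<tau>' a = b"
proof -
  define \<tau>' where "\<tau>' = (\<lambda>y. poly (map_poly \<tau> (SOME p. poly_over K p \<and> poly p a = y)) b)"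
  have eq: "\<tau>' (poly p a) = poly (map_poly \<tau> p) b" if p: "poly_over K p" for p
  proof -
    define q where "q = (SOME q. poly_over K q \<and> poly q a = poly p a)"
    have q: "poly_over K q \<and> poly q a = poly p a"
      unfolding q_def by (rule someI[of _ p]) (use p in auto)
    then have "poly (map_poly \<tau> (q - p)) b = 0" by (intro b poly_over_diff p) auto
    then show ?thesis using p q by (simp add: map_poly_hom_on(3)[OF \<tau>] \<tau>'_def q_def)
  qed
  have "\<tau>' x = \<tau> x" if "x \<in> K" for x
    using eq[of "[:x:]"] that \<tau> by (auto simp: poly_over_pCons poly_over_0 map_poly_pCons hom_on_0)
  moreover have "\<tau>' a = b"
    using eq[of "[:0,1:]"] \<tau> by (simp add: poly_over_pCons poly_over_0 subfield_0 subfield_1 map_poly_pCons hom_on_0 hom_on_1)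
  moreover have "\<tau>' (poly p a + poly q a) = \<tau>' (poly p a) + \<tau>' (poly q a)"
    "\<tau>' (poly p a * poly q a) = \<tau>' (poly p a) * \<tau>' (poly q a)" if "poly_over K p" "poly_over K q" for p q
    using eq[of "p + q"] eq[of "p * q"] eq[of p] eq[of q] that
    by (simp_all add: poly_over_add poly_over_mult map_poly_hom_on[OF \<tau>])
  ultimately show ?thesis using subfield_1 \<tau> unfolding hom_on_def
    by (intro exI[of _ \<tau>']) auto
qed

text \<open>Injectivity of \<open>\<tau>\<close> keeps the leading coefficient of the transported
  minimal polynomial nonzero, so it is not constant and has a complex root \<open>b\<close>, which
  can serve as the image of \<open>a\<close>.\<close>

lemma hom_extend_algebraic:
  assumes \<tau>: "hom_on K \<tau>" and a: "alg_over K a"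
  shows "\<exists>\<tau>'. hom_on {poly p a | p. poly_over K p} \<tau>' \<and> (\<forall>x\<in>K. \<tau>' x = \<tau> x)"
proof -
  obtain m where m: "poly_over K m" "m \<noteq> 0" "poly m a = 0" "degree m > 0"
    "\<And>p. poly_over K p \<Longrightarrow> poly p a = 0 \<Longrightarrow> \<exists>q. poly_over K q \<and> p = m * q"
    using minimal_poly_exists[OF a] by metis
  have "coeff (map_poly \<tau> m) (degree m) \<noteq> 0"
    using m by (simp add: coeff_map_poly hom_on_0[OF \<tau>] hom_on_eq_0_iff[OF \<tau>] poly_over_def)
  then have "degree (map_poly \<tau> m) \<ge> degree m" by (simp add: le_degree)
  then have "\<not> constant (poly (map_poly \<tau> m))" using m(4) constant_degree[of "map_poly \<tau> m"] by auto
  then obtain b where b: "poly (map_poly \<tau> m) b = 0" using fundamental_theorem_of_algebra by blast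
  have "poly (map_poly \<tau> p) b = 0" if "poly_over K p" "poly p a = 0" for p
    using m(5)[OF that] b m(1) by (auto simp: map_poly_hom_on[OF \<tau>])
  then show ?thesis using hom_extend_simple[OF \<tau>, of a b] by blast
qed

lemma adjoin_superset: "K \<subseteq> {poly p a | p. poly_over K p}" "a \<in> {poly p a | p. poly_over K p}"
proof -
  show "K \<subseteq> {poly p a | p. poly_over K p}"
  proof
    fix x assume "x \<in> K"
    then show "x \<in> {poly p a | p. poly_over K p}"
      by (intro CollectI exI[of _ "[:x:]"]) (simp add: poly_over_pCons poly_over_0)
  qed
  show "a \<in> {poly p a | p. poly_over K p}"
    by (intro CollectI exI[of _ "[:0,1:]"]) (simp add: poly_over_pCons poly_over_0 subfield_0 subfield_1)
qed

end

lemma alg_over_mono: "alg_over K a \<Longrightarrow> K \<subseteq> F \<Longrightarrow> alg_over F a"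
  by (auto simp: alg_over_def poly_over_def)

lemma hom_extend_finite:
  assumes "finite Z" "is_subfield K" "hom_on K \<tau>" "\<And>z. z \<in> Z \<Longrightarrow> alg_over K z"
  shows "\<exists>F \<tau>'. is_subfield F \<and> K \<union> Z \<subseteq> F \<and> hom_on F \<tau>' \<and> (\<forall>x\<in>K. \<tau>' x = \<tau> x)"
  using assms(1,4)
proof (induction Z)
  case empty
  then show ?case using assms by auto
next
  case (insert z Z)
  then obtain F \<tau>' where F: "is_subfield F" "K \<union> Z \<subseteq> F" "hom_on F \<tau>'" "\<forall>x\<in>K. \<tau>' x = \<tau> x"
    by auto
  have z: "alg_over F z" using insert.prems F(2) alg_over_mono by blast
  obtain \<tau>'' where *: "hom_on {poly p z | p. poly_over F p} \<tau>''" "\<forall>x\<in>F. \<tau>'' x = \<tau>' x"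
    using hom_extend_algebraic[OF F(1,3) z] by blast
  show ?case
    by (rule exI[of _ "{poly p z | p. poly_over F p}"], rule exI[of _ \<tau>''])
      (use * F(2,4) adjoin_superset(1)[OF F(1), of z] adjoin_superset(2)[OF F(1), of z]
        subfield_adjoin[OF F(1) z] in \<open>simp add: subset_iff\<close>)
qed

lemma is_subfield_gen_field: "is_subfield (gen_field S)"
  unfolding gen_field_def is_subfield_def by blast

lemma gen_field_superset: "S \<subseteq> gen_field S"
  by (auto simp: gen_field_def)

lemma gen_field_least: "is_subfield K \<Longrightarrow> S \<subseteq> K \<Longrightarrow> gen_field S \<subseteq> K"
  by (auto simp: gen_field_def)

lemma is_subfield_Rats: "is_subfield \<rat>"
  by (auto simp: is_subfield_def)

lemma field_autsD:
  assumes "\<sigma> \<in> field_auts L"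
  shows "hom_on L \<sigma>" "bij_betw \<sigma> L L" "\<And>x. x \<notin> L \<Longrightarrow> \<sigma> x = x" "\<And>x. x \<in> L \<Longrightarrow> \<sigma> x \<in> L"
  using assms by (auto simp: field_auts_def hom_on_def bij_betw_def)

lemma is_subfield_image:
  assumes "is_subfield K" "hom_on K \<tau>"
  shows "is_subfield (\<tau> ` K)"
  unfolding is_subfield_def
proof (intro conjI ballI impI)
  show "0 \<in> \<tau> ` K" "1 \<in> \<tau> ` K" 
    using assms by (metis hom_on_0 hom_on_1 image_eqI subfield_0 subfield_1)+
next
  fix x assume "x \<in> \<tau> ` K"
  then obtain a where *: "a \<in> K" "x = \<tau> a" by blast
  show "- x \<in> \<tau> ` K" "inverse x \<in> \<tau> ` K"
    using * hom_on_uminus[OF assms] hom_on_inverse[OF assms]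
      subfield_uminus[OF assms(1)] subfield_inverse[OF assms(1)]
    by (metis image_eqI)+
  fix y assume "y \<in> \<tau> ` K"
  then obtain b where **: "b \<in> K" "y = \<tau> b" by blast
  show "x + y \<in> \<tau> ` K" "x * y \<in> \<tau> ` K"
    using * ** hom_on_add[OF assms] hom_on_mult[OF assms] hom_on_uminus[OF assms] hom_on_inverse[OF assms]
      subfield_add[OF assms(1)] subfield_mult[OF assms(1)] subfield_uminus[OF assms(1)] subfield_inverse[OF assms(1)]
    by (metis image_eqI)+
qed

lemma is_subfield_preimage:
  assumes "is_subfield K" "hom_on K \<tau>" "is_subfield F"
  shows "is_subfield {x \<in> K. \<tau> x \<in> F}"
  using assms by (auto simp: is_subfield_def[of "Collect _"] hom_on_0 hom_on_1 hom_on_add hom_on_mult 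
     hom_on_uminus hom_on_inverse subfield_0 subfield_1 subfield_add subfield_mult subfield_uminus subfield_inverse)

text \<open>Extend the map sending x to y to all of the splitting field; the extension permutes the finite root set, hence maps
  the splitting field onto itself.\<close>
lemma conjugate_automorphism:
  assumes f: "f \<noteq> 0"
    and K: "is_subfield K" "K \<subseteq> splitting_field f"
    and x: "x \<in> splitting_field f" "alg_over K x"
    and y: "\<And>p. poly_over K p \<Longrightarrow> poly p x = 0 \<Longrightarrow> poly p y = 0"
  shows "\<exists>\<sigma>\<in>field_auts (splitting_field f). (\<forall>z\<in>K. \<sigma> z = z) \<and> \<sigma> x = y"
proof -
  define g :: "complex poly" where "g = map_poly of_rat f"
  define Z where "Z = {z. poly g z = 0}"
  define L where "L = splitting_field f"
  have L: "L = gen_field Z" by (simp add: L_def splitting_field_def Z_def g_def)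
  have g: "g \<noteq> 0" using f by (simp add: g_def map_poly_eq_0_iff)
  have gQ: "poly_over \<rat> g" by (simp add: g_def poly_over_def coeff_map_poly)
  have fin: "finite Z" unfolding Z_def using poly_roots_finite[OF g] .
  have "hom_on K id" by (simp add: hom_on_def)
  moreover have "poly (map_poly id p) y = 0" if "poly_over K p" "poly p x = 0" for p
    using y[OF that] by (simp add: map_poly_idI)
  ultimately obtain \<tau> where \<tau>: "hom_on {poly p x | p. poly_over K p} \<tau>" "\<forall>z\<in>K. \<tau> z = z" "\<tau> x = y"
    using hom_extend_simple[OF K(1), of id x y] by auto
  define E where "E = {poly p x | p. poly_over K p}"
  have E: "is_subfield E" "K \<subseteq> E" "x \<in> E"
    using subfield_adjoin[OF K(1) x(2)] adjoin_superset[OF K(1)] by (auto simp: E_def)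
  have "alg_over E z" if "z \<in> Z" for z
  proof -
    have "poly_over E g" using gQ Rats_subset_subfield[OF E(1)] by (auto simp: poly_over_def)
    then show ?thesis using that g by (auto simp: alg_over_def Z_def)
  qed
  then obtain F \<tau>' where F: "is_subfield F" "E \<union> Z \<subseteq> F" "hom_on F \<tau>'" "\<forall>x\<in>E. \<tau>' x = \<tau> x"
    using hom_extend_finite[OF fin E(1), of \<tau>] \<tau>(1) unfolding E_def by blast
  have LF: "L \<subseteq> F" unfolding L using gen_field_least F by blast
  have Lsub: "is_subfield L" unfolding L by (rule is_subfield_gen_field)
  have ZL: "Z \<subseteq> L" unfolding L by (rule gen_field_superset)
  have hL: "hom_on L \<tau>'" using F(3) LF by (auto simp: hom_on_def)
  have "\<tau>' ` Z \<subseteq> Z"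
  proof
    fix w assume "w \<in> \<tau>' ` Z"
    then obtain z where z: "z \<in> Z" "w = \<tau>' z" by blast
    have "map_poly \<tau>' g = g"
      by (rule poly_eqI) (simp add: g_def coeff_map_poly hom_on_0[OF F(1,3)] hom_on_of_rat[OF F(1,3)])
    moreover have "poly_over F g" using gQ Rats_subset_subfield[OF F(1)] by (auto simp: poly_over_def)
    ultimately have "poly g w = \<tau>' (poly g z)"
      using hom_on_poly[OF F(1,3), of g z] z F(2) by auto
    then show "w \<in> Z" using z hom_on_0[OF F(1,3)] by (simp add: Z_def)
  qed
  moreover have "inj_on \<tau>' L" by (rule hom_on_inj[OF Lsub hL])
  ultimately have im: "\<tau>' ` Z = Z"
    using fin ZL by (meson endo_inj_surj inj_on_subset)
  have "Z \<subseteq> {x \<in> L. \<tau>' x \<in> L}" using ZL im by blast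
  then have "L \<subseteq> {x \<in> L. \<tau>' x \<in> L}"
    using gen_field_least[OF is_subfield_preimage[OF Lsub hL Lsub], of Z] L by simp
  moreover have "L \<subseteq> \<tau>' ` L"
    using gen_field_least[OF is_subfield_image[OF Lsub hL], of Z] L im ZL by blast
  ultimately have bij: "\<tau>' ` L = L" by blast
  define \<sigma> where "\<sigma> = (\<lambda>x. if x \<in> L then \<tau>' x else x)"
  have "bij_betw \<sigma> L L" using bij \<open>inj_on \<tau>' L\<close> by (auto simp: bij_betw_def \<sigma>_def inj_on_def)
  then have "\<sigma> \<in> field_auts L"
    using hL Lsub by (auto simp: field_auts_def \<sigma>_def hom_on_def is_subfield_def)
  moreover have "\<forall>z\<in>K. \<sigma> z = z" using K(2) E(2) F(4) \<tau>(2) by (auto simp: \<sigma>_def L_def)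
  moreover have "\<sigma> x = y" using x(1) E(3) F(4) \<tau>(3) by (auto simp: \<sigma>_def L_def)
  ultimately show ?thesis unfolding L_def by blast
qed

text \<open>\<open>X^2 - x^2\<close> divides every such \<open>p\<close>: a nonzero remainder would
  be linear over \<open>K\<close> with root \<open>x\<close> and put \<open>x\<close> into
  \<open>K\<close>. This supplies the conjugate \<open>-x\<close> for
  \<open>conjugate_automorphism\<close>.\<close>

lemma conjugate_uminus:
  assumes K: "is_subfield K" and x: "x \<notin> K" "x^2 \<in> K" and p: "poly_over K p" "poly p x = 0"
  shows "poly p (-x) = 0"
proof -
  define m where "m = [:-(x^2), 0, 1:]"
  have m: "poly_over K m" "m \<noteq> 0" "degree m = 2"
    using x by (auto simp: m_def poly_over_pCons[OF K] poly_over_0[OF K] subfield_0[OF K] subfield_1[OF K] subfield_uminus[OF K])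
  obtain q r where *: "poly_over K r" "p = m * q + r" "r = 0 \<or> degree r < 2"
    using poly_over_division[OF K m(1,2) p(1)] m(3) by metis
  have r: "poly r x = 0" using p * by (simp add: m_def power2_eq_square)
  have "r = 0"
  proof (rule ccontr)
    assume "r \<noteq> 0"
    obtain a b where r': "r = [:a, b:]"
    proof
      show "r = [:coeff r 0, coeff r 1:]"
      proof (rule poly_eqI)
        fix i show "coeff r i = coeff [:coeff r 0, coeff r 1:] i"
          using *(3) \<open>r \<noteq> 0\<close> coeff_eq_0[of r i]
          by (cases i; cases "i - 1") (auto simp: coeff_pCons split: nat.split)
      qed
    qed
    have "a \<in> K" "b \<in> K" using *(1) by (auto simp: r' poly_over_pCons[OF K])
    moreover have "b \<noteq> 0" using r r' \<open>r \<noteq> 0\<close> by auto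
    moreover have "x = - a / b" using r r' \<open>b \<noteq> 0\<close> by (simp add: field_simps eq_neg_iff_add_eq_0)
    ultimately show False using x(1) subfield_divide[OF K] subfield_uminus[OF K] by blast
  qed
  then show ?thesis using * by (simp add: m_def power2_eq_square)
qed

section \<open>Conjugates of roots of unity\<close>

definition int_eval :: "int poly \<Rightarrow> complex \<Rightarrow> complex" where
  "int_eval P x = poly (map_poly of_int P) x"

lemma int_eval_pCons [simp]: "int_eval (pCons a P) x = of_int a + x * int_eval P x"
  by (simp add: int_eval_def map_poly_pCons)

lemma int_eval_0 [simp]: "int_eval 0 x = 0" and int_eval_1 [simp]: "int_eval 1 x = 1"
  by (simp_all add: int_eval_def)

lemma int_eval_add [simp]: "int_eval (P + Q) x = int_eval P x + int_eval Q x"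
proof -
  have "map_poly of_int (P + Q) = map_poly of_int P + (map_poly of_int Q :: complex poly)"
    by (rule poly_eqI) (simp add: coeff_map_poly)
  then show ?thesis by (simp add: int_eval_def)
qed

lemma int_eval_mult [simp]: "int_eval (P * Q) x = int_eval P x * int_eval Q x"
proof -
  have "map_poly of_int (P * Q) = map_poly of_int P * (map_poly of_int Q :: complex poly)"
    by (rule poly_eqI) (simp add: coeff_map_poly coeff_mult)
  then show ?thesis by (simp add: int_eval_def)
qed

lemma int_eval_uminus [simp]: "int_eval (- P) x = - int_eval P x"
  using int_eval_add[of P "-P" x] by (simp del: int_eval_add add: add_eq_0_iff)

lemma int_eval_diff [simp]: "int_eval (P - Q) x = int_eval P x - int_eval Q x"
  using int_eval_add[of P "-Q" x] by simp

lemma int_eval_smult [simp]: "int_eval (smult c P) x = of_int c * int_eval P x"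
  using int_eval_mult[of "[:c:]" P x] by simp

lemma int_eval_power [simp]: "int_eval (P ^ k) x = int_eval P x ^ k"
  by (induction k) auto

lemma int_eval_monom [simp]: "int_eval (monom c k) x = of_int c * x ^ k"
  by (simp add: int_eval_def map_poly_monom poly_monom)

lemma int_eval_pcompose: "int_eval (pcompose P Q) x = int_eval P (int_eval Q x)"
  by (induction P) (auto simp: pcompose_pCons)

text \<open>Kept with an explicit error term in an arbitrary commutative ring, since it serves both
  for integers and for integer polynomials.\<close>

lemma freshmans_dream_mod:
  fixes x y :: "'a :: comm_ring_1"
  assumes "prime p"
  shows "\<exists>z. (x + y) ^ p = x ^ p + y ^ p + of_nat p * z"
proof -
  have p: "p > 0" using assms by (simp add: prime_gt_0_nat)
  have "\<exists>z. of_nat (p choose k) * x ^ k * y ^ (p - k) = of_nat p * z" if "k \<in> {1..<p}" for k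
  proof -
    have "p dvd (p choose k)" using assms that by (intro dvd_choose_prime) auto
    then obtain m where "p choose k = p * m" by (auto elim: dvdE)
    then show ?thesis by (intro exI[of _ "of_nat m * x ^ k * y ^ (p - k)"]) (simp add: mult.assoc)
  qed
  then obtain z where z: "\<And>k. k \<in> {1..<p} \<Longrightarrow> of_nat (p choose k) * x ^ k * y ^ (p - k) = of_nat p * z k"
    by metis
  have "{..p} = insert 0 (insert p {1..<p})" using p by auto
  then have "(x + y) ^ p = y ^ p + (x ^ p + (\<Sum>k\<in>{1..<p}. of_nat (p choose k) * x ^ k * y ^ (p - k)))"
    using p by (simp add: binomial_ring)
  also have "(\<Sum>k\<in>{1..<p}. of_nat (p choose k) * x ^ k * y ^ (p - k)) = of_nat p * (\<Sum>k\<in>{1..<p}. z k)"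
    by (simp add: z sum_distrib_left)
  finally show ?thesis by (intro exI[of _ "\<Sum>k\<in>{1..<p}. z k"]) (simp add: add_ac)
qed

lemma fermat_int:
  fixes a :: int
  assumes p: "prime p"
  shows "int p dvd a ^ p - a"
proof -
  have *: "int p dvd int a ^ p - int a" for a
  proof (induction a)
    case 0
    then show ?case using prime_gt_0_nat[OF p] by (simp add: power_0_left)
  next
    case (Suc a)
    obtain z where "(int a + 1) ^ p = int a ^ p + 1 ^ p + of_nat p * z"
      using freshmans_dream_mod[OF p] by metis
    then have "int (Suc a) ^ p - int (Suc a) = (int a ^ p - int a) + int p * z"
      by (simp add: add.commute)
    then show ?case using Suc by (simp only: dvd_add dvd_triv_left)
  qed
  define b where "b = nat (a mod int p)"
  have "int p > 0" using p prime_gt_0_nat by simp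
  then have b: "[a = int b] (mod int p)" by (simp add: b_def cong_def)
  have "[a ^ p - a = int b ^ p - int b] (mod int p)"
    by (intro cong_diff cong_pow b)
  then show ?thesis using *[of b] by (metis cong_dvd_iff)
qed

text \<open>Frobenius modulo \<open>p\<close>: \<open>h(X^p)\<close> and \<open>h(X)^p\<close> agree
  up to a multiple of \<open>p\<close>. The error \<open>B\<close> is explicit so that the identity
  can be evaluated at a complex number.\<close>

lemma pcompose_monom_prime:
  fixes h :: "int poly"
  assumes p: "prime p"
  shows "\<exists>B. pcompose h (monom 1 p) = h ^ p + smult (int p) B"
proof (induction h)
  case 0
  then show ?case using p by (intro exI[of _ 0]) (simp add: prime_gt_0_nat power_0_left)
next
  case (pCons a h)
  obtain B where B: "pcompose h (monom 1 p) = h ^ p + smult (int p) B" using pCons by blast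
  obtain z where z: "([:a:] + [:0,1:] * h) ^ p = [:a:] ^ p + ([:0,1:] * h) ^ p + of_nat p * z"
    using freshmans_dream_mod[OF p] by metis
  obtain k where k: "a ^ p - a = int p * k" using fermat_int[OF p] by (auto elim: dvdE)
  have X: "monom 1 p = ([:0,1:] :: int poly) ^ p" by (simp add: monom_altdef)
  have ap: "[:a:] ^ p = [:a:] + smult (int p) [:k:]" using k by (simp add: poly_const_pow algebra_simps)
  have "pCons a h = [:a:] + [:0,1:] * h" by simp
  then have "pCons a h ^ p = [:a:] + smult (int p) [:k:] + [:0,1:] ^ p * h ^ p + smult (int p) z"
    using z ap by (simp add: power_mult_distrib of_nat_poly del: mult_pCons_left) (simp add: mult_ac)
  moreover have "pcompose (pCons a h) (monom 1 p) = [:a:] + [:0,1:] ^ p * (h ^ p + smult (int p) B)"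
    using B by (simp add: pcompose_pCons X)
  ultimately have "pcompose (pCons a h) (monom 1 p) = pCons a h ^ p + smult (int p) ([:0,1:] ^ p * B - [:k:] - z)"
    by (simp add: algebra_simps smult_diff_right smult_add_right)
  then show ?case by blast
qed

text \<open>By Gauss's lemma the primitive part \<open>g1\<close> of an annihilator of least degree
  divides every other annihilator over the integers; dividing \<open>X^n - 1\<close>, it has leading
  coefficient 1 or -1.\<close>

lemma integral_minimal_poly:
  fixes \<zeta> :: complex
  assumes \<zeta>: "\<zeta> ^ n = 1" "n > 0"
  obtains g where "lead_coeff g = 1" "int_eval g \<zeta> = 0" "\<And>P. int_eval P \<zeta> = 0 \<Longrightarrow> g dvd P"
proof -
  define N :: "int poly" where "N = monom 1 n - 1"
  have N: "int_eval N \<zeta> = 0" using \<zeta> by (simp add: N_def)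
  have cN: "coeff N n = 1" using \<zeta> by (simp add: N_def)
  have "degree N = n" unfolding N_def using \<zeta> 
    by (subst degree_add_eq_left[of "-1" "monom 1 n" for n, simplified diff_conv_add_uminus[symmetric]]) (auto simp: degree_monom_eq)
  then have lN: "lead_coeff N = 1" using cN by simp
  define S where "S = (\<lambda>P. P \<noteq> 0 \<and> int_eval P \<zeta> = 0)"
  have "S N" using N cN by (auto simp: S_def)
  then obtain g0 where g0: "S g0" "\<And>P. S P \<Longrightarrow> degree g0 \<le> degree P"
    using ex_has_least_nat[of S _ degree] by blast
  define g1 where "g1 = primitive_part g0"
  have eq: "g0 = smult (content g0) g1" by (simp add: g1_def)
  then have "int_eval g0 \<zeta> = of_int (content g0) * int_eval g1 \<zeta>" by (metis int_eval_smult)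
  then have g1: "int_eval g1 \<zeta> = 0" "g1 \<noteq> 0" "content g1 = 1" "degree g1 = degree g0"
    using g0(1) by (auto simp: S_def g1_def)
  have dvd: "g1 dvd P" if P: "int_eval P \<zeta> = 0" for P
  proof -
    obtain q r where qr: "pseudo_divmod P g1 = (q, r)" by force
    define a where "a = lead_coeff g1 ^ (Suc (degree P) - degree g1)"
    have a: "a \<noteq> 0" using g1(2) by (simp add: a_def del: leading_coeff_0_iff) (simp add: g1(2))
    have *: "smult a P = g1 * q + r" "r = 0 \<or> degree r < degree g1"
      using pseudo_divmod[OF g1(2) qr] by (auto simp: a_def)
    have "int_eval (smult a P) \<zeta> = int_eval (g1 * q + r) \<zeta>" using * by simp
    then have "int_eval r \<zeta> = 0" using P g1 by simp
    then have r: "r = 0" using *(2) g0(2)[of r] g1(4) by (force simp: S_def)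
    \<comment> \<open>The content is multiplicative and \<open>g1\<close> is primitive, so the
      factor \<open>a\<close> introduced by pseudo-division is absorbed by \<open>q\<close>.\<close>
    have "content (smult a P) = content q" using *(1) r g1(3) by (simp add: content_mult)
    then have "a dvd content q" by (metis content_smult dvd_normalize_iff dvd_triv_left normalize_dvd_iff)
    then have "[:a:] dvd q" by (simp add: const_poly_dvd_iff_dvd_content)
    then obtain q' where "q = smult a q'" by (auto elim: dvdE)
    then have "smult a P = smult a (g1 * q')" using * r by simp
    then have "P = g1 * q'" using a by (metis smult_cancel)
    then show ?thesis by simp
  qed
  obtain k where "N = g1 * k" using dvd[OF N] by (auto elim: dvdE)
  then have "lead_coeff g1 * lead_coeff k = 1" using lN by (metis lead_coeff_mult)
  then have lc: "lead_coeff g1 * lead_coeff g1 = 1" by (metis pos_zmult_eq_1_iff_lemma zmult_eq_1_iff mult_minus_left mult_minus_right mult_1 minus_minus)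
  define g where "g = smult (lead_coeff g1) g1"
  show thesis
  proof (rule that[of g])
    show "lead_coeff g = 1" using lc g1(2) by (simp add: g_def)
    show "int_eval g \<zeta> = 0" using g1 by (simp add: g_def)
    fix P assume P: "int_eval P \<zeta> = 0"
    obtain q where "P = g1 * q" using dvd[OF P] by (auto elim: dvdE)
    then have "P = g * smult (lead_coeff g1) q" using lc by (simp add: g_def)
    then show "g dvd P" by (rule dvdI)
  qed
qed

text \<open>Write \<open>X^n - 1 = g * h\<close>. If \<open>g\<close> does not vanish at
  \<open>\<zeta>^p\<close>, then \<open>h\<close> does, and the Frobenius congruence makes
  \<open>h(\<zeta>)^p\<close> a multiple of \<open>p\<close> in \<open>Z[\<zeta>]\<close>. This is
  the classical irreducibility argument for cyclotomic polynomials, carried out in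
  \<open>Z[\<zeta>]\<close> instead of over the field with \<open>p\<close> elements.\<close>

lemma int_eval_root_unity_prime:
  assumes \<zeta>: "\<zeta> ^ n = 1" "n > 0" and p: "prime p" "\<not> p dvd n" and P: "int_eval P \<zeta> = 0"
  shows "int_eval P (\<zeta> ^ p) = 0"
proof -
  obtain g where g: "lead_coeff g = 1" "int_eval g \<zeta> = 0" "\<And>P. int_eval P \<zeta> = 0 \<Longrightarrow> g dvd P"
    using integral_minimal_poly[OF \<zeta>] by metis
  have "int_eval g (\<zeta> ^ p) = 0"
  proof (rule ccontr)
    assume g': "int_eval g (\<zeta> ^ p) \<noteq> 0"
    define N :: "int poly" where "N = monom 1 n - 1"
    have "int_eval N \<zeta> = 0" using \<zeta> by (simp add: N_def)
    then obtain h where h: "N = g * h" using g(3) by (auto elim: dvdE)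
    have "int_eval N (\<zeta> ^ p) = 0" using \<zeta> by (simp add: N_def power_mult[symmetric] mult.commute[of p]) (simp add: power_mult)
    then have hp: "int_eval h (\<zeta> ^ p) = 0" using g' h by simp
    obtain B where B: "pcompose h (monom 1 p) = h ^ p + smult (int p) B"
      using pcompose_monom_prime[OF p(1)] by blast
    have "int_eval (pcompose h (monom 1 p)) \<zeta> = 0" using hp by (simp add: int_eval_pcompose)
    then have hB: "int_eval h \<zeta> ^ p = - (of_nat p * int_eval B \<zeta>)" by (simp add: B add_eq_0_iff2)
    \<comment> \<open>The derivative of \<open>X^n - 1\<close> at \<open>\<zeta>\<close> replaces
      separability modulo \<open>p\<close>: it shows that \<open>h(\<zeta>)\<close> divides
      \<open>n\<close> in \<open>Z[\<zeta>]\<close>, whence \<open>p\<close> divides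
      \<open>n^p\<close> there.\<close>
    have "pderiv N = monom (int n) (n - 1)" by (simp add: N_def pderiv_diff pderiv_monom)
    then have "int_eval (monom (int n) (n - 1)) \<zeta> = int_eval (pderiv (g * h)) \<zeta>" using h by simp
    then have "of_nat n * \<zeta> ^ (n - 1) = int_eval h \<zeta> * int_eval (pderiv g) \<zeta>"
      using g(2) by (simp add: pderiv_mult)
    then have "of_nat n * \<zeta> ^ n = int_eval h \<zeta> * (\<zeta> * int_eval (pderiv g) \<zeta>)"
      using \<zeta>(2) by (cases n) (auto simp: algebra_simps)
    then have V: "of_nat n = int_eval h \<zeta> * int_eval ([:0,1:] * pderiv g) \<zeta>" using \<zeta> by simp
    define W where "W = - (B * ([:0,1:] * pderiv g) ^ p)"
    have W: "of_nat n ^ p = of_nat p * int_eval W \<zeta>"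
      unfolding V W_def by (simp add: power_mult_distrib hB del: mult_pCons_left)
    have "coprime (int n ^ p) (int p)"
      using p by (metis coprime_commute coprime_int_iff coprime_power_left_iff of_nat_power prime_imp_coprime_nat)
    then obtain r s where rs: "r * int n ^ p + s * int p = 1" by (metis coprime_iff_gcd_eq_1 bezout_int)
    have "(of_int (r * int n ^ p + s * int p) :: complex) = 1" by (simp only: rs of_int_1)
    then have one: "of_nat p * int_eval (smult r W + [:s:]) \<zeta> = 1"
      using W by (simp add: algebra_simps)
    \<comment> \<open>\<open>p\<close> is now a unit in \<open>Z[\<zeta>]\<close>. Reduction by the
      monic \<open>g\<close> represents its inverse by \<open>W0\<close> of degree below that of
      \<open>g\<close>, so \<open>p * W0 = 1\<close> must hold already as polynomials.\<close>
    obtain q W0 where qr: "pseudo_divmod (smult r W + [:s:]) g = (q, W0)" by force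
    have g0: "g \<noteq> 0" using g(1) by auto
    have *: "smult r W + [:s:] = g * q + W0" "W0 = 0 \<or> degree W0 < degree g"
      using pseudo_divmod[OF g0 qr] g(1) by auto
    have "of_nat p * int_eval W0 \<zeta> = 1" using one g(2) unfolding *(1) by simp
    then have "int_eval (smult (int p) W0 - 1) \<zeta> = 0" by simp
    then have gd: "g dvd smult (int p) W0 - 1" by (rule g(3))
    have "smult (int p) W0 - 1 = 0"
    proof (rule ccontr)
      assume nz: "smult (int p) W0 - 1 \<noteq> 0"
      have dg: "degree g > 0"
      proof (rule ccontr)
        assume "\<not> ?thesis"
        then obtain c where "g = [:c:]" by (metis degree_eq_zeroE not_gr0)
        then show False using g by simp
      qed
      have "degree (smult (int p) W0 - 1) < degree g"
        using *(2) dg by (intro degree_diff_less) auto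
      moreover have "degree g \<le> degree (smult (int p) W0 - 1)" using gd nz by (rule dvd_imp_degree_le)
      ultimately show False by simp
    qed
    then have "coeff (smult (int p) W0 - 1) 0 = 0" by simp
    then have "int p * coeff W0 0 = 1" by simp
    then have "int p dvd 1" by (metis dvd_triv_left)
    then show False using p(1) by (simp add: prime_nat_iff)
  qed
  moreover obtain q where "P = g * q" using g(3)[OF P] by (auto elim: dvdE)
  ultimately show ?thesis by simp
qed

text \<open>Prime factors of \<open>k\<close> are split off one at a time, each
  \<open>\<zeta>^p\<close> being again an \<open>n\<close>th root of unity. The case
  \<open>k = 0\<close> occurs only for \<open>n = 1\<close>, where
  \<open>\<zeta> = 1\<close>.\<close>

lemma int_eval_root_unity_coprime:
  assumes "n > 0" "coprime k n" "\<zeta> ^ n = 1" "int_eval P \<zeta> = 0"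
  shows "int_eval P (\<zeta> ^ k) = 0"
  using assms(2-)
proof (induction k arbitrary: \<zeta> rule: less_induct)
  case (less k)
  consider "k = 0" | "k = 1" | "k > 1" by linarith
  then show ?case
  proof cases
    case 1
    then show ?thesis using less.prems by simp
  next
    case 2
    then show ?thesis using less.prems by simp
  next
    case 3
    then obtain p where p: "prime p" "p dvd k" using prime_factor_nat[of k] by auto
    then obtain l where l: "k = p * l" by (auto elim: dvdE)
    have "l > 0" using 3 l by (cases l) auto
    then have "l < k" using l prime_gt_1_nat[OF p(1)] by simp
    moreover have "\<not> p dvd n" using p less.prems(1) by (meson coprime_common_divisor_nat coprime_def not_prime_unit)
    then have "int_eval P (\<zeta> ^ p) = 0" using int_eval_root_unity_prime[OF less.prems(2) assms(1) p(1)] less.prems(3) by simp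
    moreover have "(\<zeta> ^ p) ^ n = 1" using less.prems(2) by (metis power_mult mult.commute power_one)
    moreover have "coprime l n" using less.prems(1) l by simp
    ultimately show ?thesis using less.IH[of l "\<zeta> ^ p"] by (simp add: l power_mult)
  qed
qed

lemma clear_denominators:
  assumes "poly_over \<rat> p"
  shows "\<exists>c P. c \<noteq> 0 \<and> smult (of_int c) p = map_poly of_int P"
  using assms
proof (induction p)
  case 0
  then show ?case by (intro exI[of _ 1] exI[of _ 0]) auto
next
  case (pCons a p)
  then have a: "a \<in> \<rat>" and "poly_over \<rat> p" by (auto simp: poly_over_pCons[OF is_subfield_Rats])
  then obtain c P where c: "c \<noteq> 0" "smult (of_int c) p = map_poly of_int P" using pCons by blast
  obtain u v where uv: "v \<noteq> 0" "a = of_int u / of_int v"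
    using a by (metis Rats_cases' less_irrefl)
  have "smult (of_int (c * v)) (pCons a p) = map_poly of_int (pCons (c * u) (smult v P))"
  proof -
    have "smult (of_int v) (smult (of_int c) p) = smult (of_int v) (map_poly of_int P :: complex poly)" using c by simp
    also have "\<dots> = map_poly of_int (smult v P)" by (rule poly_eqI) (simp add: coeff_map_poly)
    finally show ?thesis using uv by (simp add: map_poly_pCons mult.commute)
  qed
  moreover have "c * v \<noteq> 0" using c uv by simp
  ultimately show ?case by blast
qed

text \<open>The irreducibility of the cyclotomic polynomial, in the form needed for the conjugates
  of \<open>c 1\<close>.\<close>

lemma rat_poly_root_unity:
  assumes "n > 0" "coprime k n" "\<zeta> ^ n = 1" "poly_over \<rat> p" "poly p \<zeta> = 0"
  shows "poly p (\<zeta> ^ k) = 0"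
proof -
  obtain c P where c: "c \<noteq> 0" "smult (of_int c) p = map_poly of_int P" using clear_denominators[OF assms(4)] by blast
  have eq: "int_eval P x = of_int c * poly p x" for x unfolding int_eval_def c(2)[symmetric] by simp
  show ?thesis using int_eval_root_unity_coprime[OF assms(1-3), of P] assms(5) c(1) by (simp add: eq)
qed

section \<open>The Waring identity for De Moivre polynomials\<close>

text \<open>This is \<open>sqrt D ^ k * F_k (x / sqrt D)\<close>, the homogenised Chebyshev
  polynomial; the recurrence needs no square root of \<open>D\<close>.\<close>

fun lucas_V :: "'a::comm_ring_1 \<Rightarrow> 'a \<Rightarrow> nat \<Rightarrow> 'a" where
  "lucas_V x D 0 = 2"
| "lucas_V x D (Suc 0) = x"
| "lucas_V x D (Suc (Suc k)) = x * lucas_V x D (Suc k) - D * lucas_V x D k"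

text \<open>The companion of \<open>lucas_V\<close>: for \<open>x = a + b\<close> and
  \<open>D = a * b\<close> it is \<open>(a^k - b^k) / (a - b)\<close>.\<close>

fun lucas_U :: "'a::comm_ring_1 \<Rightarrow> 'a \<Rightarrow> nat \<Rightarrow> 'a" where
  "lucas_U x D 0 = 0"
| "lucas_U x D (Suc 0) = 1"
| "lucas_U x D (Suc (Suc k)) = x * lucas_U x D (Suc k) - D * lucas_U x D k"

lemma lucas_V_sum: "lucas_V (a + b) (a * b) k = a ^ k + b ^ k"
  by (induction "a + b" "a * b" k rule: lucas_V.induct) (simp_all add: algebra_simps)

lemma lucas_U_sum: "lucas_U (a + b) (a * b) k * (a - b) = a ^ k - b ^ k"
proof (induction "a + b" "a * b" k rule: lucas_U.induct)
  case (3 k)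
  have "lucas_U (a + b) (a * b) (Suc (Suc k)) * (a - b)
      = (a + b) * (lucas_U (a + b) (a * b) (Suc k) * (a - b)) - a * b * (lucas_U (a + b) (a * b) k * (a - b))"
    by (simp add: algebra_simps)
  then show ?case unfolding 3 by (simp add: algebra_simps)
qed simp_all

text \<open>The unsigned coefficient of Waring's formula. At \<open>k = j = 0\<close> it is
  \<open>0 / 0 * 1\<close>, that is 0, whereas \<open>lucas_V\<close> starts at 2; hence the
  restriction to positive \<open>k\<close> and the separate treatment of index 2 in
  \<open>waring\<close>.\<close>

definition waring_coeff :: "nat \<Rightarrow> nat \<Rightarrow> 'a::field_char_0" where
  "waring_coeff k j = of_nat k / of_nat (k - j) * of_nat ((k - j) choose j)"

lemma waring_coeff_0: "k > 0 \<Longrightarrow> waring_coeff k 0 = 1"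
  by (simp add: waring_coeff_def)

text \<open>Splitting \<open>k\<close> into \<open>k - Suc j\<close> and \<open>Suc j\<close> clears
  the denominator and leaves a sum of two binomials, to which Pascal's rule applies.\<close>

lemma waring_coeff_binomial:
  assumes "2 * Suc j \<le> k"
  shows "waring_coeff k (Suc j) = of_nat (((k - Suc j) choose Suc j) + ((k - Suc (Suc j)) choose j))"
proof -
  have *: "Suc j * ((k - Suc j) choose Suc j) = (k - Suc j) * ((k - Suc (Suc j)) choose j)"
    using times_binomial_minus1_eq[of "Suc j" "k - Suc j"] by simp
  then have "k * ((k - Suc j) choose Suc j)
      = (k - Suc j) * (((k - Suc j) choose Suc j) + ((k - Suc (Suc j)) choose j))"
  proof -
    have "k = (k - Suc j) + Suc j" using assms by simp
    then have "k * ((k - Suc j) choose Suc j) = (k - Suc j) * ((k - Suc j) choose Suc j) + Suc j * ((k - Suc j) choose Suc j)"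
      by (metis add_mult_distrib)
    with * show ?thesis by (simp add: add_mult_distrib2)
  qed
  then have "(of_nat k :: 'a) * of_nat ((k - Suc j) choose Suc j)
      = of_nat (k - Suc j) * of_nat (((k - Suc j) choose Suc j) + ((k - Suc (Suc j)) choose j))"
    by (metis of_nat_mult)
  moreover have "(of_nat (k - Suc j) :: 'a) \<noteq> 0" using assms by (subst of_nat_eq_0_iff) simp
  ultimately show ?thesis
    unfolding waring_coeff_def
    by (simp only: times_divide_eq_left nonzero_mult_div_cancel_left simp_thms)
qed

lemma waring_coeff_eq_0: "k < 2 * j \<Longrightarrow> waring_coeff k j = 0"
  by (simp add: waring_coeff_def binomial_eq_0)

lemma waring_coeff_rec:
  assumes "k > 0" "2 * j \<le> k"
  shows "(waring_coeff (Suc (Suc k)) (Suc j) :: 'a::field_char_0) = waring_coeff (Suc k) (Suc j) + waring_coeff k j"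
proof -
  have 1: "(waring_coeff (Suc (Suc k)) (Suc j) :: 'a)
      = of_nat ((Suc (k - j) choose Suc j) + ((k - j) choose j))"
    using assms by (subst waring_coeff_binomial) (auto simp: Suc_diff_le)
  have 2: "(waring_coeff (Suc k) (Suc j) :: 'a) = of_nat (((k - j) choose Suc j) + ((k - Suc j) choose j))"
  proof (cases "2 * Suc j \<le> Suc k")
    case True
    then show ?thesis by (subst waring_coeff_binomial) auto
  next
    \<comment> \<open>Here \<open>k = 2 * j\<close> with \<open>j\<close> positive, so both
      binomials vanish together with the coefficient.\<close>
    case False
    then have "k = 2 * j" using assms by simp
    then show ?thesis using assms by (subst waring_coeff_eq_0) (auto simp: binomial_eq_0)
  qed
  show ?thesis
  proof (cases j)
    case 0
    then show ?thesis using assms 1 2 by (simp add: waring_coeff_0)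
  next
    case (Suc i)
    have 3: "(waring_coeff k j :: 'a) = of_nat (((k - j) choose j) + ((k - Suc j) choose i))"
      unfolding Suc using assms Suc by (subst waring_coeff_binomial) auto
    have "k - j = Suc (k - Suc j)" using assms Suc by simp
    then have "((k - j) choose j) = ((k - Suc j) choose i) + ((k - Suc j) choose j)" using Suc by simp
    then show ?thesis by (simp add: 1 2 3)
  qed
qed

lemma waring:
  fixes x D :: "'a::field_char_0"
  assumes "k > 0"
  shows "(\<Sum>j\<le>k div 2. waring_coeff k j * (- D) ^ j * x ^ (k - 2 * j)) = lucas_V x D k"
  using assms
proof (induction x D k rule: lucas_V.induct)
  case (3 x D k)
  show ?case
  proof (cases "k = 0")
    case True
    then show ?thesis by (simp add: waring_coeff_def power2_eq_square)
  next
    case False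
    define G where "G = (\<lambda>k j. waring_coeff k j * (- D) ^ j * x ^ (k - 2 * j))"
    have IH: "(\<Sum>j\<le>Suc k div 2. G (Suc k) j) = lucas_V x D (Suc k)" "(\<Sum>j\<le>k div 2. G k j) = lucas_V x D k"
      using 3 False by (auto simp: G_def)
    \<comment> \<open>For even \<open>k\<close> the right-hand sum has one more term, whose
      coefficient is zero; the two sums of the recurrence then match in range.\<close>
    have ext: "(\<Sum>j\<le>Suc k div 2. G (Suc k) j) = (\<Sum>j\<le>Suc (k div 2). G (Suc k) j)"
      by (rule sum.mono_neutral_left) (auto simp: G_def waring_coeff_eq_0)
    have step: "G (Suc (Suc k)) (Suc j) = x * G (Suc k) (Suc j) - D * G k j" if "j \<le> k div 2" for j
    proof -
      have j: "2 * j \<le> k" using that by simp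
      \<comment> \<open>Where the exponent \<open>Suc k - 2 * Suc j\<close> would be truncated at 0,
        the coefficient is zero.\<close>
      have *: "waring_coeff (Suc k) (Suc j) * x ^ (k - 2 * j) = waring_coeff (Suc k) (Suc j) * (x * x ^ (Suc k - 2 * Suc j))"
      proof (cases "2 * Suc j \<le> Suc k")
        case True
        then have "k - 2 * j = Suc (Suc k - 2 * Suc j)" by simp
        then show ?thesis by (simp only: power_Suc)
      next
        case False
        then show ?thesis by (simp add: waring_coeff_eq_0)
      qed
      have "G (Suc (Suc k)) (Suc j)
          = (- D) ^ Suc j * (waring_coeff (Suc k) (Suc j) * x ^ (k - 2 * j)) + (- D) ^ Suc j * (waring_coeff k j * x ^ (k - 2 * j))"
        unfolding G_def waring_coeff_rec[OF _ j, of] using False j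
        by (subst waring_coeff_rec) (auto simp: algebra_simps)
      also have "\<dots> = x * G (Suc k) (Suc j) - D * G k j"
        unfolding * by (simp add: G_def algebra_simps)
      finally show ?thesis .
    qed
    have "(\<Sum>j\<le>Suc (Suc k) div 2. G (Suc (Suc k)) j) = G (Suc (Suc k)) 0 + (\<Sum>j\<le>k div 2. G (Suc (Suc k)) (Suc j))"
      by (simp add: sum.atMost_Suc_shift del: sum.atMost_Suc)
    also have "\<dots> = x * G (Suc k) 0 + (\<Sum>j\<le>k div 2. x * G (Suc k) (Suc j) - D * G k j)"
      using step by (simp add: G_def waring_coeff_0)
    also have "\<dots> = x * (\<Sum>j\<le>Suc (k div 2). G (Suc k) j) - D * (\<Sum>j\<le>k div 2. G k j)"
      by (simp add: sum.atMost_Suc_shift sum_subtractf sum_distrib_left algebra_simps del: sum.atMost_Suc)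
    finally show ?thesis using IH ext by (simp add: G_def)
  qed
qed (auto simp: waring_coeff_def)

section \<open>From the recurrence to the De Moivre polynomial\<close>

definition rat_eval :: "rat poly \<Rightarrow> complex \<Rightarrow> complex" where
  "rat_eval p x = poly (map_poly of_rat p) x"

lemma rat_eval_add: "rat_eval (p + q) x = rat_eval p x + rat_eval q x"
proof -
  have "map_poly of_rat (p + q) = map_poly of_rat p + (map_poly of_rat q :: complex poly)"
    by (rule poly_eqI) (simp add: coeff_map_poly of_rat_add)
  then show ?thesis by (simp add: rat_eval_def)
qed

lemma rat_eval_diff: "rat_eval (p - q) x = rat_eval p x - rat_eval q x"
  using rat_eval_add[of "p - q" q x] by simp

lemma rat_eval_mult: "rat_eval (p * q) x = rat_eval p x * rat_eval q x"
proof -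
  have "map_poly of_rat (p * q) = map_poly of_rat p * (map_poly of_rat q :: complex poly)"
    by (rule poly_eqI) (simp add: coeff_map_poly coeff_mult of_rat_mult of_rat_sum)
  then show ?thesis by (simp add: rat_eval_def)
qed

lemma rat_eval_sum: "rat_eval (sum g A) x = (\<Sum>i\<in>A. rat_eval (g i) x)"
  by (induction A rule: infinite_finite_induct) (auto simp: rat_eval_add, auto simp: rat_eval_def)

lemma rat_eval_simps:
  "rat_eval (monom c k) x = of_rat c * x ^ k" "rat_eval [:c:] x = of_rat c" "rat_eval 1 x = 1"
  by (simp_all add: rat_eval_def map_poly_monom poly_monom map_poly_pCons)

text \<open>Oddness makes \<open>(n - 1) div 2\<close> the full range \<open>n div 2\<close> of
  Waring's formula.\<close>

lemma rat_eval_de_moivre_poly: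
  assumes "odd n"
  shows "rat_eval (de_moivre_poly n d R) x
    = lucas_V x (of_rat (d^2 - R)) n - 2 * of_rat d * of_rat (d^2 - R) ^ ((n - 1) div 2)"
proof -
  define D where "D = d^2 - R"
  have n: "n > 0" "n div 2 = (n - 1) div 2" using assms by (auto elim: oddE)
  have "rat_eval (de_moivre_poly n d R) x
     = (\<Sum>j\<le>(n - 1) div 2. waring_coeff n j * (- of_rat D) ^ j * x ^ (n - 2 * j)) - 2 * of_rat d * of_rat D ^ ((n - 1) div 2)"
    unfolding de_moivre_poly_def Let_def D_def[symmetric] rat_eval_diff rat_eval_sum rat_eval_simps
    by (simp add: of_rat_mult of_rat_divide of_rat_power waring_coeff_def of_rat_minus mult_ac
         power_minus[of "of_rat D"] del: of_nat_diff)
  then show ?thesis using waring[OF n(1), of "of_rat D" x] n(2) by (simp add: D_def)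
qed

section \<open>The action on the roots\<close>

lemma quadratic_split:
  fixes x P :: complex
  shows "\<exists>a b. x = a + b \<and> a * b = P"
proof -
  define s where "s = csqrt (x^2 - 4 * P)"
  have "s^2 = x^2 - 4 * P" by (simp add: s_def)
  moreover have "(x + s) / 2 * ((x - s) / 2) = (x^2 - s^2) / 4" by (simp add: algebra_simps power2_eq_square)
  ultimately have "(x + s) / 2 * ((x - s) / 2) = P" by simp
  moreover have "x = (x + s) / 2 + (x - s) / 2" by (simp add: add_divide_distrib[symmetric])
  ultimately show ?thesis by blast
qed

lemma sum_prod_eq:
  fixes a b x y :: complex
  assumes "a + b = x + y" "a * b = x * y"
  shows "a = x \<and> b = y \<or> a = y \<and> b = x"
proof -
  have "(a - x) * (a - y) = a * a - a * (x + y) + x * y" by (simp add: algebra_simps)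
  also have "\<dots> = 0" unfolding assms[symmetric] by (simp add: algebra_simps)
  finally show ?thesis using assms(1) by auto
qed

text \<open>If \<open>y^n = d + \<rho>\<close>, \<open>y'^n = d - \<rho>\<close> and
  \<open>z = y * y'\<close> with \<open>z^n = D\<close>, then \<open>z^((n-1)/2) * y\<close> and
  \<open>z^((n-1)/2) * y'\<close> satisfy the conditions on \<open>t\<close> and \<open>t'\<close>.
  The two conditions on \<open>\<zeta>\<close> say that it is a primitive \<open>n\<close>th root of
  unity; integer exponents allow negative indices.\<close>

locale de_moivre =
  fixes n :: nat and d R :: rat and \<zeta> t t' \<rho> :: complex
  assumes n3: "n \<ge> 3" and odd_n: "odd n" and d0: "d \<noteq> 0"
    and rho2: "\<rho>^2 = of_rat R" and rho0: "\<rho> \<noteq> 0" and D0: "d^2 - R \<noteq> 0"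
    and tt': "t * t' = of_rat (d^2 - R)"
    and t_pow: "t ^ n = of_rat (d^2 - R) ^ ((n - 1) div 2) * (of_rat d + \<rho>)"
    and t'_pow: "t' ^ n = of_rat (d^2 - R) ^ ((n - 1) div 2) * (of_rat d - \<rho>)"
    and zeta_powi_eq_1: "\<And>k. \<zeta> powi k = 1 \<longleftrightarrow> int n dvd k"
    and root_unity_powi: "\<And>w. w ^ n = 1 \<Longrightarrow> \<exists>k. w = \<zeta> powi k"
    and irr: "irreducible (de_moivre_poly n d R)"
begin

abbreviation "f \<equiv> de_moivre_poly n d R"
abbreviation "L \<equiv> splitting_field f"
abbreviation "DD \<equiv> complex_of_rat (d^2 - R)"
definition "z k = \<zeta> powi k"
definition "u j = z j * t + z (-j) * t'"
definition "c j = z j + z (-j)"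
definition "e j = (z j - z (-j)) * \<rho>"
text \<open>Chosen so that \<open>t^n + t'^n\<close> is \<open>\<kappa> * d\<close> and
  \<open>t^n - t'^n\<close> is \<open>\<kappa> * \<rho>\<close>.\<close>

definition "\<kappa> = 2 * DD ^ ((n - 1) div 2)"

section \<open>The roots and their index arithmetic\<close>

lemma n0: "n > 0" using n3 by simp

lemma zeta_pow_n: "\<zeta> ^ n = 1"
  using zeta_powi_eq_1[of "int n"] by simp

lemma zeta0: "\<zeta> \<noteq> 0"
  using zeta_pow_n n0 by (metis power_0_left less_irrefl zero_neq_one)

lemma z_add: "z (i + j) = z i * z j"
  unfolding z_def using zeta0 by (simp add: power_int_add)

lemma z_0 [simp]: "z 0 = 1" by (simp add: z_def)

lemma z_nz [simp]: "z i \<noteq> 0"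
  using zeta0 by (simp add: z_def)

lemma z_minus_mult: "z i * z (-i) = 1" "z (-i) * z i = 1"
  using z_add[of i "-i"] z_add[of "-i" i] by auto

lemma z_eq_1_iff: "z i = 1 \<longleftrightarrow> int n dvd i"
  using zeta_powi_eq_1 by (simp add: z_def)

lemma z_eq_iff: "z i = z j \<longleftrightarrow> int n dvd i - j"
proof -
  have "z i = z (i - j) * z j" by (simp add: z_add[symmetric])
  then have "z i = z j \<longleftrightarrow> z (i - j) = 1" by simp
  then show ?thesis by (simp add: z_eq_1_iff)
qed

lemma z_pow: "z i ^ k = z (int k * i)"
  by (simp add: z_def power_int_power' mult.commute)

lemma z_pow_n [simp]: "z i ^ n = 1"
  by (simp add: z_pow z_eq_1_iff)

lemma DD0: "DD \<noteq> 0" using D0 by simp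

lemma kappa0: "\<kappa> \<noteq> 0" using DD0 by (simp add: \<kappa>_def del: of_rat_diff)

lemma t_diff: "t ^ n - t' ^ n = \<kappa> * \<rho>" and t_sum: "t ^ n + t' ^ n = \<kappa> * of_rat d"
  by (simp_all add: t_pow t'_pow \<kappa>_def algebra_simps)

lemma uu': "(z j * t) * (z (-j) * t') = DD"
proof -
  have "(z j * t) * (z (-j) * t') = (z j * z (-j)) * (t * t')" by (simp only: mult_ac)
  then show ?thesis by (simp only: z_minus_mult tt' mult_1)
qed

lemma t0: "t \<noteq> 0" "t' \<noteq> 0" using tt' DD0 by auto

lemma u_shift: "u (j + k) = z k * (z j * t) + z (-k) * (z (-j) * t')"
  using z_add[of "-j" "-k"] by (simp add: u_def z_add mult_ac)

lemma u_shift_minus: "u (j - k) = z (-k) * (z j * t) + z k * (z (-j) * t')"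
  using u_shift[of j "-k"] by simp

text \<open>The analogue of \<open>2 cos (x + y) + 2 cos (x - y) = (2 cos y) (2 cos x)\<close>.
  Together with \<open>u_mult\<close> it determines the unordered pair \<open>u (j + k)\<close>,
  \<open>u (j - k)\<close> from \<open>u j\<close> and \<open>c k\<close>.\<close>

lemma u_add: "u (j + k) + u (j - k) = c k * u j"
  unfolding u_shift u_shift_minus by (simp add: c_def u_def algebra_simps)

lemma u_diff: "u (j + k) - u (j - k) = (z k - z (-k)) * (z j * t - z (-j) * t')"
  unfolding u_shift u_shift_minus by (simp add: algebra_simps)

lemma u_mult: "u (j + k) * u (j - k) = u j ^ 2 + (c k ^ 2 - 4) * DD"
proof -
  have *: "(p * a + q * b) * (q * a + p * b) = (a + b)^2 + ((p + q)^2 - 4) * (a * b)"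
    if "p * q = 1" for a b p q :: complex
  proof -
    have "(p * a + q * b) * (q * a + p * b) = (p * q) * (a^2 + b^2) + (p^2 + q^2) * (a * b)"
      by (simp add: algebra_simps power2_eq_square)
    moreover have "(p + q)^2 = p^2 + q^2 + 2 * (p * q)" by (simp add: algebra_simps power2_eq_square)
    ultimately show ?thesis using that by (simp add: algebra_simps power2_eq_square)
  qed
  show ?thesis
    unfolding u_shift u_shift_minus *[OF z_minus_mult(1)] uu' by (simp add: c_def u_def)
qed

lemma rat_eval_f: "rat_eval f (a + b) = a ^ n + b ^ n - \<kappa> * of_rat d" if "a * b = DD"
  using rat_eval_de_moivre_poly[OF odd_n, of d R "a + b"] lucas_V_sum[of a b n]
  unfolding that \<kappa>_def by simp

text \<open>If \<open>x = a + b\<close> is a root and \<open>a * b = D\<close>, then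
  \<open>a^n\<close> and \<open>b^n\<close> have the sum and product of \<open>t^n\<close> and
  \<open>t'^n\<close>, so one of \<open>a\<close>, \<open>b\<close> is \<open>t\<close> times an
  \<open>n\<close>th root of unity.\<close>

lemma f_root_iff: "rat_eval f x = 0 \<longleftrightarrow> (\<exists>j. x = u j)"
proof
  assume x: "rat_eval f x = 0"
  obtain a b where ab: "x = a + b" "a * b = DD" using quadratic_split by blast
  have 1: "a ^ n + b ^ n = t ^ n + t' ^ n" using x rat_eval_f[OF ab(2)] by (simp add: ab(1) t_sum)
  have 2: "a ^ n * b ^ n = t ^ n * t' ^ n" using ab(2) tt' by (metis power_mult_distrib)
  have *: "\<exists>j. a' + b' = u j" if "a' ^ n = t ^ n" "a' * b' = DD" for a' b'
  proof -
    have "(a' / t) ^ n = 1" using that t0 by (simp add: power_divide)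
    then obtain j where "a' / t = z j" using root_unity_powi unfolding z_def by blast
    then have a': "a' = z j * t" using t0 by (simp add: field_simps)
    have "a' \<noteq> 0" using that DD0 by auto
    moreover have "a' * b' = a' * (z (-j) * t')" using that(2) uu'[of j] unfolding a' by simp
    ultimately have "b' = z (-j) * t'" by simp
    then show ?thesis using a' unfolding u_def by blast
  qed
  show "\<exists>j. x = u j"
    using sum_prod_eq[OF 1 2] *[of a b] *[of b a] ab by (auto simp: add.commute mult.commute)
next
  assume "\<exists>j. x = u j"
  then obtain j where "x = u j" by blast
  then show "rat_eval f x = 0"
    using rat_eval_f[OF uu'[of j]] by (simp add: u_def power_mult_distrib t_sum)
qed

text \<open>The only other coincidence, \<open>z i * t = z (-j) * t'\<close>, would equate
  \<open>t^n\<close> and \<open>t'^n\<close>, whose difference is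
  \<open>\<kappa> * \<rho>\<close>.\<close>

lemma u_eq_iff: "u i = u j \<longleftrightarrow> int n dvd i - j"
proof
  assume eq: "u i = u j"
  have "(z i * t = z j * t \<and> z (-i) * t' = z (-j) * t') \<or> (z i * t = z (-j) * t' \<and> z (-i) * t' = z j * t)"
    using eq uu'[of i] uu'[of j] by (intro sum_prod_eq) (auto simp: u_def)
  moreover have "z i * t \<noteq> z (-j) * t'"
  proof
    assume "z i * t = z (-j) * t'"
    then have "(z i * t) ^ n = (z (-j) * t') ^ n" by simp
    then have "t ^ n - t' ^ n = 0" by (simp add: power_mult_distrib)
    then show False using t_diff kappa0 rho0 by simp
  qed
  ultimately show "int n dvd i - j" using t0 z_eq_iff by simp
next
  assume "int n dvd i - j"
  then have "z i = z j" "z (-i) = z (-j)"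
    using z_eq_iff[of "-i" "-j"] by (auto simp: z_eq_iff dvd_diff_commute)
  then show "u i = u j" by (simp add: u_def)
qed

lemma c_eq_iff: "c i = c j \<longleftrightarrow> int n dvd i - j \<or> int n dvd i + j"
proof -
  have "c i = c j \<longleftrightarrow> z i = z j \<or> z i = z (-j)"
  proof
    assume "c i = c j"
    then have "z i + z (-i) = z j + z (-j)" by (simp add: c_def)
    from sum_prod_eq[OF this] show "z i = z j \<or> z i = z (-j)" by (auto simp: z_minus_mult)
  next
    assume "z i = z j \<or> z i = z (-j)"
    then show "c i = c j" unfolding c_def
      by (metis z_minus_mult add.commute mult_left_cancel z_nz)
  qed
  then show ?thesis by (simp add: z_eq_iff)
qed

text \<open>For odd \<open>n\<close> a zero root would give \<open>t^n = - t'^n\<close>, against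
  \<open>d \<noteq> 0\<close>. This licenses the division in \<open>c_eq\<close>.\<close>

lemma u_nz: "u j \<noteq> 0"
proof
  assume "u j = 0"
  then have "z j * t = - (z (-j) * t')" by (simp add: u_def add_eq_0_iff2)
  then have "(z j * t) ^ n = - ((z (-j) * t') ^ n)" using odd_n by simp
  then have "t ^ n + t' ^ n = 0" by (simp add: power_mult_distrib)
  then show False using t_sum kappa0 d0 by simp
qed

lemma f0: "f \<noteq> 0" using irr by auto

lemma splitting_eq: "L = gen_field (range u)"
proof -
  have "{z. poly (map_poly of_rat f) z = 0} = range u"
    using f_root_iff by (auto simp: rat_eval_def)
  then show ?thesis by (simp add: splitting_field_def)
qed

lemma L: "is_subfield L" unfolding splitting_field_def by (rule is_subfield_gen_field)

lemma u_L: "u j \<in> L" using gen_field_superset[of "range u"] by (auto simp: splitting_eq)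

text \<open>The free index \<open>j\<close>, here and in \<open>e_eq\<close>, matters: an
  automorphism is applied to the expression with \<open>j = 0\<close>, and the result is recognised
  as the expression with \<open>j = b\<close>.\<close>

lemma c_eq: "c k = (u (j + k) + u (j - k)) / u j"
  using u_add[of j k] u_nz[of j] by (simp add: field_simps)

lemma c_L: "c k \<in> L"
  unfolding c_eq[of k 0] by (intro subfield_divide[OF L] subfield_add[OF L] u_L)

text \<open>\<open>lucas_U (u j) DD n\<close> times \<open>z j * t - z (-j) * t'\<close> is
  \<open>t^n - t'^n\<close>, so it turns a difference of roots into the rational multiple
  \<open>\<kappa> * e k\<close>.\<close>

lemma e_eq: "e k = (u (j + k) - u (j - k)) * lucas_U (u j) DD n / \<kappa>"
proof -
  have "(u (j + k) - u (j - k)) * lucas_U (u j) DD n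
    = (z k - z (-k)) * (lucas_U (z j * t + z (-j) * t') ((z j * t) * (z (-j) * t')) n * (z j * t - z (-j) * t'))"
    unfolding uu' u_diff by (simp add: u_def)
  also have "\<dots> = (z k - z (-k)) * (t ^ n - t' ^ n)"
    unfolding lucas_U_sum by (simp add: power_mult_distrib)
  finally show ?thesis using kappa0 by (simp add: t_diff e_def)
qed

lemma DD_L: "DD \<in> L" by (rule subfield_of_rat[OF L])

lemma kappa_L: "\<kappa> \<in> L"
  unfolding \<kappa>_def using subfield_of_nat[OF L, of 2] by (intro subfield_mult[OF L] subfield_power[OF L] DD_L) simp

lemma lucas_L: "x \<in> L \<Longrightarrow> y \<in> L \<Longrightarrow> lucas_U x y k \<in> L" "x \<in> L \<Longrightarrow> y \<in> L \<Longrightarrow> lucas_V x y k \<in> L"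
proof -
  have 2: "2 \<in> L" using subfield_of_nat[OF L, of 2] by simp
  show "x \<in> L \<Longrightarrow> y \<in> L \<Longrightarrow> lucas_U x y k \<in> L" "x \<in> L \<Longrightarrow> y \<in> L \<Longrightarrow> lucas_V x y k \<in> L"
    by (induction x y k rule: lucas_U.induct)
      (auto simp: 2 subfield_0[OF L] subfield_1[OF L] intro!: subfield_diff[OF L] subfield_mult[OF L])
qed

lemma e_L: "e k \<in> L"
  unfolding e_eq[of k 0]
  by (intro subfield_divide[OF L] subfield_mult[OF L] subfield_diff[OF L] u_L lucas_L DD_L kappa_L)

section \<open>The action of one automorphism\<close>

context
  fixes \<sigma> assumes \<sigma>: "\<sigma> \<in> field_auts L"
begin

lemma sig_hom: "hom_on L \<sigma>" using field_autsD[OF \<sigma>] by blast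

lemmas sig_simps = hom_on_add[OF L sig_hom] hom_on_diff[OF L sig_hom] hom_on_mult[OF L sig_hom]
  hom_on_divide[OF L sig_hom] hom_on_of_rat[OF L sig_hom] hom_on_0[OF L sig_hom] hom_on_1[OF L sig_hom]

lemma sig_2: "\<sigma> 2 = 2" using hom_on_of_nat[OF L sig_hom, of 2] by simp

lemma sig_power: "x \<in> L \<Longrightarrow> \<sigma> (x ^ k) = \<sigma> x ^ k"
  by (induction k) (auto simp: sig_simps subfield_power[OF L])

lemma sig_lucas: "x \<in> L \<Longrightarrow> y \<in> L \<Longrightarrow> \<sigma> (lucas_U x y k) = lucas_U (\<sigma> x) (\<sigma> y) k"
  "x \<in> L \<Longrightarrow> y \<in> L \<Longrightarrow> \<sigma> (lucas_V x y k) = lucas_V (\<sigma> x) (\<sigma> y) k"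
  by (induction x y k rule: lucas_U.induct)
    (auto simp: sig_simps sig_2 lucas_L subfield_mult[OF L])

lemma sig_kappa: "\<sigma> \<kappa> = \<kappa>"
  unfolding \<kappa>_def using subfield_of_nat[OF L, of 2] DD_L
  by (simp add: sig_simps sig_2 sig_power subfield_power[OF L] del: of_rat_diff)

lemma sig_root: "\<exists>b. \<sigma> (u j) = u b"
proof -
  have "rat_eval f (\<sigma> (u j)) = \<sigma> (rat_eval f (u j))"
  proof -
    define k where "k = 2 * d * (d^2 - R) ^ ((n - 1) div 2)"
    have *: "rat_eval f x = lucas_V x DD n - of_rat k" for x
      unfolding rat_eval_de_moivre_poly[OF odd_n] k_def of_rat_mult of_rat_power by simp
    show ?thesis unfolding * 
      by (simp add: sig_simps sig_lucas u_L DD_L lucas_L subfield_of_rat[OF L] del: of_rat_diff)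
  qed
  also have "rat_eval f (u j) = 0" using f_root_iff by blast
  finally show ?thesis using f_root_iff by (simp add: sig_simps)
qed

text \<open>\<open>\<sigma>\<close> sends \<open>c 1\<close> to some \<open>c k\<close>, so the pair
  \<open>\<sigma> (u 1)\<close>, \<open>\<sigma> (u (-1))\<close> has the sum and product of
  \<open>u (b + k)\<close>, \<open>u (b - k)\<close>. The recurrence
  \<open>u (j + 1) + u (j - 1) = c 1 * u j\<close> propagates this to all indices.\<close>

lemma sig_affine: "\<exists>a b. coprime a (int n) \<and> (\<forall>j. \<sigma> (u j) = u (b + a * j))"
proof -
  obtain b where b: "\<sigma> (u 0) = u b" using sig_root by blast
  \<comment> \<open>The solutions of \<open>lucas_V x 1 n = 2\<close> are the \<open>w + 1/w\<close>
    with \<open>w^n = 1\<close>, that is, the \<open>c k\<close>.\<close>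
  have "lucas_V (c 1) 1 n = 2"
    using lucas_V_sum[of "z 1" "z (-1)" n] by (simp add: z_minus_mult c_def)
  then have V: "lucas_V (\<sigma> (c 1)) 1 n = 2"
    using sig_lucas(2)[of "c 1" 1 n] by (simp add: c_L sig_simps sig_2 subfield_1[OF L])
  obtain w w' where w: "\<sigma> (c 1) = w + w'" "w * w' = 1" using quadratic_split by metis
  have 1: "w ^ n + w' ^ n = 1 + 1" using V lucas_V_sum[of w w' n] w by simp
  have 2: "w ^ n * w' ^ n = 1 * 1" using w(2) by (metis power_mult_distrib power_one mult_1)
  have "w ^ n = 1" using sum_prod_eq[OF 1 2] by auto
  then obtain k where k: "w = z k" using root_unity_powi unfolding z_def by blast
  have "w' = z (-k)" using w(2) k by (metis z_minus_mult(1) mult_left_cancel z_nz)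
  then have ck: "\<sigma> (c 1) = c k" using w k by (simp add: c_def)
  have "\<sigma> (u 1) + \<sigma> (u (-1)) = u (b + k) + u (b - k)"
    using u_add[of 0 1] u_add[of b k] sig_simps u_L c_L b ck by (metis add_0 diff_0)
  moreover have "\<sigma> (u 1) * \<sigma> (u (-1)) = u (b + k) * u (b - k)"
  proof -
    have "\<sigma> (u 1) * \<sigma> (u (-1)) = \<sigma> (u 0 ^ 2 + (c 1 ^ 2 - of_rat 4) * DD)"
      using u_mult[of 0 1] by (simp add: sig_simps u_L flip: sig_simps(3))
    also have "\<dots> = u b ^ 2 + (c k ^ 2 - of_rat 4) * DD"
      using b ck subfield_of_rat[OF L, of 4]
      by (simp add: sig_simps sig_power u_L c_L DD_L subfield_power[OF L] subfield_diff[OF L]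
           subfield_mult[OF L] subfield_of_rat[OF L] del: of_rat_diff of_rat_numeral_eq)
    also have "\<dots> = u (b + k) * u (b - k)" using u_mult[of b k] by simp
    finally show ?thesis .
  qed
  \<comment> \<open>Since \<open>c (-k) = c k\<close>, the sign of \<open>k\<close> is still free;
    \<open>a\<close> is the choice that matches \<open>\<sigma> (u 1)\<close>.\<close>
  ultimately have "\<exists>a. \<sigma> (u 1) = u (b + a) \<and> c a = c k"
    using sum_prod_eq[of "\<sigma> (u 1)" "\<sigma> (u (-1))" "u (b + k)" "u (b - k)"]
    by (metis c_eq_iff add.right_inverse dvd_0_right diff_conv_add_uminus add.left_inverse)
  then obtain a where a: "\<sigma> (u 1) = u (b + a)" "c a = c k" by blast
  have "\<sigma> (u j) = u (b + a * j) \<and> \<sigma> (u (j + 1)) = u (b + a * (j + 1))" for j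
  proof (induction j rule: int_induct[of _ 0])
    case base
    then show ?case using a b by simp
  next
    case (step1 i)
    have "u (i + 1 + 1) = c 1 * u (i + 1) - u i" using u_add[of "i + 1" 1] by (simp add: algebra_simps)
    then have "\<sigma> (u (i + 1 + 1)) = c k * u (b + a * (i + 1)) - u (b + a * i)"
      using step1 ck by (simp add: sig_simps subfield_mult[OF L] c_L u_L)
    also have "\<dots> = u (b + a * (i + 1 + 1))" using u_add[of "b + a * (i + 1)" a] a(2)
      by (simp add: algebra_simps)
    finally show ?case using step1 by simp
  next
    case (step2 i)
    have "u (i - 1) = c 1 * u i - u (i + 1)" using u_add[of i 1] by (simp add: algebra_simps)
    then have "\<sigma> (u (i - 1)) = c k * u (b + a * i) - u (b + a * (i + 1))"
      using step2 ck by (simp add: sig_simps subfield_mult[OF L] c_L u_L)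
    also have "\<dots> = u (b + a * (i - 1))" using u_add[of "b + a * i" a] a(2)
      by (simp add: algebra_simps)
    finally show ?case using step2 by simp
  qed
  then have aff: "\<sigma> (u j) = u (b + a * j)" for j by blast
  have "coprime a (int n)"
  proof -
    \<comment> \<open>With \<open>n = g * n'\<close>, the roots \<open>u n'\<close> and
      \<open>u 0\<close> have the same image, and injectivity forces \<open>g\<close> to be a
      unit.\<close>
    define g where "g = gcd a (int n)"
    obtain a' n' where g: "a = g * a'" "int n = g * n'" unfolding g_def by (meson dvdE gcd_dvd1 gcd_dvd2)
    have "int n dvd a * n'" using g by (simp add: mult_ac)
    then have "\<sigma> (u n') = \<sigma> (u 0)" by (simp add: aff u_eq_iff)
    then have "u n' = u 0" using hom_on_inj[OF L sig_hom] u_L by (auto simp: inj_on_def)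
    then have "g * n' dvd n'" using g(2) by (simp add: u_eq_iff)
    moreover have "n' \<noteq> 0" using g n0 by auto
    ultimately have "g dvd 1" by auto
    then show ?thesis unfolding g_def using is_unit_gcd by blast
  qed
  then show ?thesis using aff by blast
qed

lemma sig_c: "\<forall>j. \<sigma> (u j) = u (b + a * j) \<Longrightarrow> \<sigma> (c k) = c (a * k)"
  unfolding c_eq[of k 0] c_eq[of "a * k" b]
  by (simp add: sig_simps subfield_add[OF L] u_L)

lemma sig_e: "\<forall>j. \<sigma> (u j) = u (b + a * j) \<Longrightarrow> \<sigma> (e k) = e (a * k)"
  unfolding e_eq[of k 0] e_eq[of "a * k" b]
  by (simp add: sig_simps sig_kappa sig_lucas subfield_diff[OF L] subfield_mult[OF L] lucas_L u_L DD_L kappa_L del: of_rat_diff)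

end

lemma aut_eqI:
  assumes "\<sigma> \<in> field_auts L" "\<tau> \<in> field_auts L" "\<And>j. \<sigma> (u j) = \<tau> (u j)"
  shows "\<sigma> = \<tau>"
proof
  fix x
  let ?E = "{x \<in> L. \<sigma> x = \<tau> x}"
  note h = field_autsD(1)[OF assms(1)] field_autsD(1)[OF assms(2)]
  have "is_subfield ?E"
    by (auto simp: is_subfield_def[of ?E] hom_on_0[OF L] hom_on_1[OF L] hom_on_add[OF L] hom_on_mult[OF L]
     hom_on_uminus[OF L] hom_on_inverse[OF L] subfield_0[OF L] subfield_1[OF L] subfield_add[OF L]
     subfield_mult[OF L] subfield_uminus[OF L] subfield_inverse[OF L] h)
  then have "L \<subseteq> ?E" using gen_field_least[of ?E "range u"] u_L assms(3) splitting_eq by auto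
  then show "\<sigma> x = \<tau> x" using field_autsD(3)[OF assms(1)] field_autsD(3)[OF assms(2)] by (cases "x \<in> L") auto
qed

end

section \<open>Which affine maps are realised\<close>

text \<open>Being the identity outside \<open>L\<close>, an automorphism is a bijection of all
  complex numbers; hence \<open>inv_into UNIV\<close> can serve as the group inverse.\<close>

lemma field_auts_bij: "\<sigma> \<in> field_auts L \<Longrightarrow> bij \<sigma>"
proof -
  assume \<sigma>: "\<sigma> \<in> field_auts L"
  have "bij_betw \<sigma> (- L) (- L)"
    using field_autsD(3)[OF \<sigma>] by (auto simp: bij_betw_def inj_on_def image_def)
  then show "bij \<sigma>" using bij_betw_combine[OF field_autsD(2)[OF \<sigma>], of "- L" "- L"] by simp
qed

lemma field_auts_id: "id \<in> field_auts L"
  by (simp add: field_auts_def)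

lemma field_auts_comp:
  assumes "\<sigma> \<in> field_auts L" "\<tau> \<in> field_auts L"
  shows "\<sigma> \<circ> \<tau> \<in> field_auts L"
  using assms field_autsD(4)[OF assms(2)] bij_betw_trans[of \<tau> L L \<sigma> L]
  by (simp add: field_auts_def)

lemma field_auts_inv:
  assumes L: "is_subfield L" and \<sigma>: "\<sigma> \<in> field_auts L"
  shows "inv_into UNIV \<sigma> \<in> field_auts L"
proof -
  note b = field_auts_bij[OF \<sigma>]
  have surj: "\<sigma> (inv_into UNIV \<sigma> x) = x" for x using b by (simp add: bij_is_surj surj_f_inv_f)
  have inj: "inv_into UNIV \<sigma> (\<sigma> x) = x" for x using b by (simp add: bij_is_inj)
  have mem: "inv_into UNIV \<sigma> x \<in> L" if "x \<in> L" for x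
    using field_autsD(2)[OF \<sigma>] that inj unfolding bij_betw_def by (metis imageE)
  have "bij_betw (inv_into UNIV \<sigma>) L L"
    by (rule bij_betwI[of _ _ _ \<sigma>]) (use mem field_autsD(4)[OF \<sigma>] surj inj in auto)
  moreover have "inv_into UNIV \<sigma> (x + y) = inv_into UNIV \<sigma> x + inv_into UNIV \<sigma> y" "inv_into UNIV \<sigma> (x * y) = inv_into UNIV \<sigma> x * inv_into UNIV \<sigma> y" if "x \<in> L" "y \<in> L" for x y
    using hom_on_add[OF L field_autsD(1)[OF \<sigma>] mem[OF that(1)] mem[OF that(2)]]
      hom_on_mult[OF L field_autsD(1)[OF \<sigma>] mem[OF that(1)] mem[OF that(2)]] surj inj by metis+
  moreover have "inv_into UNIV \<sigma> 1 = 1" using inj[of 1] hom_on_1[OF L field_autsD(1)[OF \<sigma>]] by simp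
  moreover have "inv_into UNIV \<sigma> x = x" if "x \<notin> L" for x using field_autsD(3)[OF \<sigma> that] inj[of x] by simp
  ultimately show ?thesis by (simp add: field_auts_def)
qed

lemma alg_over_sqrt:
  assumes "is_subfield K" "x^2 \<in> K"
  shows "alg_over K x"
  unfolding alg_over_def
  by (rule exI[of _ "[:-(x^2), 0, 1:]"])
    (use assms in \<open>auto simp: poly_over_pCons poly_over_0 subfield_0 subfield_1 subfield_uminus power2_eq_square\<close>)

lemma poly_over_pcompose:
  assumes K: "is_subfield K" and "poly_over K p" "poly_over K q"
  shows "poly_over K (pcompose p q)"
  using assms(2)
  by (induction p)
    (auto simp: pcompose_pCons poly_over_pCons[OF K] poly_over_0[OF K] assms(3)
      intro!: poly_over_add[OF K] poly_over_mult[OF K])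

context de_moivre
begin

text \<open>The Galois group read as a set of affine maps on indices: \<open>a\<close> is the
  multiplier and \<open>b\<close> the translation part, integers that matter only modulo
  \<open>n\<close> (\<open>affine_cong\<close>).\<close>

definition "affine a b \<longleftrightarrow> (\<exists>\<sigma>\<in>field_auts L. \<forall>j. \<sigma> (u j) = u (b + a * j))"

lemma affine_cong_iff:
  "(\<forall>j. u (b + a * j) = u (b' + a' * j)) \<longleftrightarrow> int n dvd b - b' \<and> int n dvd a - a'"
proof
  assume "\<forall>j. u (b + a * j) = u (b' + a' * j)"
  then have "int n dvd (b + a * j) - (b' + a' * j)" for j by (simp add: u_eq_iff)
  from this[of 0] this[of 1] have *: "int n dvd b - b'" "int n dvd (b + a) - (b' + a')" by auto
  from dvd_diff[OF *(2,1)] * show "int n dvd b - b' \<and> int n dvd a - a'" by (simp add: algebra_simps)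
next
  assume *: "int n dvd b - b' \<and> int n dvd a - a'"
  have "(b + a * j) - (b' + a' * j) = (b - b') + (a - a') * j" for j by (simp add: algebra_simps)
  then show "\<forall>j. u (b + a * j) = u (b' + a' * j)" using * unfolding u_eq_iff by (metis dvd_add dvd_mult2)
qed

lemma affine_cong: "affine a b \<Longrightarrow> int n dvd a - a' \<Longrightarrow> int n dvd b - b' \<Longrightarrow> affine a' b'"
  using affine_cong_iff[of b a b' a'] by (auto simp: affine_def)

lemma affine_coprime: "affine a b \<Longrightarrow> coprime a (int n)"
proof -
  assume "affine a b"
  then obtain \<sigma> where \<sigma>: "\<sigma> \<in> field_auts L" "\<forall>j. \<sigma> (u j) = u (b + a * j)" by (auto simp: affine_def)
  obtain a' b' where *: "coprime a' (int n)" "\<forall>j. \<sigma> (u j) = u (b' + a' * j)" using sig_affine[OF \<sigma>(1)] by blast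
  then have "int n dvd a - a'" using affine_cong_iff[of b a b' a'] \<sigma>(2) by simp
  then show ?thesis using *(1) by (metis cong_iff_dvd_diff cong_sym cong_imp_coprime)
qed

lemma affine_mult: "affine a b \<Longrightarrow> affine a' b' \<Longrightarrow> affine (a * a') (b + a * b')"
proof -
  assume "affine a b" "affine a' b'"
  then obtain \<sigma> \<tau> where *: "\<sigma> \<in> field_auts L" "\<forall>j. \<sigma> (u j) = u (b + a * j)"
    "\<tau> \<in> field_auts L" "\<forall>j. \<tau> (u j) = u (b' + a' * j)" by (auto simp: affine_def)
  then have "\<forall>j. (\<sigma> \<circ> \<tau>) (u j) = u ((b + a * b') + (a * a') * j)" by (simp add: algebra_simps)
  then show ?thesis unfolding affine_def using field_auts_comp *(1,3) by blast
qed

lemma affine_inverse: "affine a b \<Longrightarrow> \<exists>a' b'. affine a' b' \<and> int n dvd a * a' - 1 \<and> int n dvd b + a * b'"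
proof -
  assume "affine a b"
  then obtain \<sigma> where \<sigma>: "\<sigma> \<in> field_auts L" "\<forall>j. \<sigma> (u j) = u (b + a * j)" by (auto simp: affine_def)
  obtain a' b' where *: "\<forall>j. inv_into UNIV \<sigma> (u j) = u (b' + a' * j)"
    using sig_affine[OF field_auts_inv[OF L \<sigma>(1)]] by blast
  have inv: "\<sigma> (inv_into UNIV \<sigma> (u j)) = u j" for j using field_auts_bij[OF \<sigma>(1)] by (simp add: bij_is_surj surj_f_inv_f)
  then have "u ((b + a * b') + (a * a') * j) = u (0 + 1 * j)" for j
  proof -
    have eq: "(b + a * b') + (a * a') * j = b + a * (b' + a' * j)" by (simp add: algebra_simps)
    show ?thesis unfolding eq using * \<sigma>(2) inv[of j] by simp
  qed
  then have "int n dvd (b + a * b') - 0 \<and> int n dvd a * a' - 1" using affine_cong_iff by blast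
  moreover have "affine a' b'" using * field_auts_inv[OF L \<sigma>(1)] by (auto simp: affine_def)
  ultimately show ?thesis by auto
qed

lemma affine_translation_diff: "affine a b \<Longrightarrow> affine a b' \<Longrightarrow> affine 1 (b - b')"
proof -
  assume *: "affine a b" "affine a b'"
  obtain a1 b1 where 1: "affine a1 b1" "int n dvd a * a1 - 1" "int n dvd b' + a * b1" using affine_inverse[OF *(2)] by blast
  show ?thesis
    by (rule affine_cong[OF affine_mult[OF *(1) 1(1)] 1(2)]) (use 1(3) in \<open>simp add: add.commute\<close>)
qed

lemma affine_translation_add: "affine 1 b \<Longrightarrow> affine a b' \<Longrightarrow> affine a (b + b')"
  using affine_mult[of 1 b a b'] by simp

lemma affine_id: "affine 1 0"
  unfolding affine_def by (rule bexI[of _ id]) (auto simp: field_auts_id)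

lemma affine_translation_mult: "affine 1 b \<Longrightarrow> affine 1 (k * b)"
proof -
  assume b: "affine 1 b"
  have *: "affine 1 (int m * b)" for m
    by (induction m) (auto simp: affine_id algebra_simps intro!: affine_translation_add[OF b])
  have "int n dvd int (nat (k mod int n)) * b - k * b"
    using n0 by (simp add: left_diff_distrib[symmetric] mod_eq_dvd_iff[symmetric])
  then show ?thesis using affine_cong[OF *[of "nat (k mod int n)"], of 1 "k * b"] by (simp only: diff_self dvd_0_right)
qed

lemma affine_translation_gcd: "affine 1 x \<Longrightarrow> affine 1 y \<Longrightarrow> affine 1 (gcd x y)"
  using affine_translation_add[OF affine_translation_mult affine_translation_mult] bezout_int[of x y] by metis

text \<open>The products in the two orders have the same multiplier, so they differ by a translation
  of the group.\<close>

lemma affine_commutator: "affine a b \<Longrightarrow> affine a' b' \<Longrightarrow> affine 1 (b * (1 - a') - b' * (1 - a))"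
  using affine_translation_diff[OF affine_mult[of a b a' b'], of "b' + a' * b"] affine_mult[of a' b' a b]
  by (simp add: algebra_simps)

section \<open>Automorphisms supplied by irreducibility\<close>

lemma u_alg: "alg_over \<rat> (u j)"
proof -
  have "poly (map_poly of_rat f) (u j) = 0" using f_root_iff rat_eval_def by auto
  moreover have "(map_poly of_rat f :: complex poly) \<noteq> 0" using f0 by (simp add: map_poly_eq_0_iff)
  ultimately show ?thesis unfolding alg_over_def poly_over_def
    by (intro exI[of _ "map_poly of_rat f"]) (simp add: coeff_map_poly)
qed

text \<open>The irreducible \<open>f\<close> divides every rational polynomial vanishing at
  \<open>u 0\<close>, so \<open>u b\<close> is a conjugate of \<open>u 0\<close>.\<close>

lemma affine_transitive: "\<exists>a. affine a b"
proof -
  have "poly p (u b) = 0" if p: "poly_over \<rat> p" "poly p (u 0) = 0" for p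
  proof -
    have "\<forall>i. \<exists>q. coeff p i = of_rat q" using p(1) by (auto simp: poly_over_def Rats_def)
    then obtain q where q: "\<And>i. coeff p i = of_rat (q i)" by metis
    define p0 where "p0 = (\<Sum>i\<le>degree p. monom (q i) i)"
    have "q i = 0" if "i > degree p" for i using q[of i] that by (simp add: coeff_eq_0)
    then have c: "coeff p0 i = q i" for i
      by (cases "i \<le> degree p") (auto simp: p0_def coeff_sum not_le)
    have pp: "map_poly of_rat p0 = p" by (rule poly_eqI) (simp add: coeff_map_poly c q)
    have p0: "rat_eval p0 x = poly p x" for x by (simp add: rat_eval_def pp)
    have "f dvd p0"
    proof (rule ccontr)
      assume "\<not> f dvd p0"
      then have "coprime f p0" using irr by (simp add: prime_elem_imp_coprime irreducible_imp_prime_elem_gcd)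
      then obtain r s where "r * f + s * p0 = 1"
        by (metis bezout_coefficients_fst_snd coprime_iff_gcd_eq_1)
      then have "rat_eval (r * f + s * p0) (u 0) = 1" by (simp add: rat_eval_simps)
      moreover have "rat_eval f (u 0) = 0" using f_root_iff by blast
      ultimately show False using p(2) by (simp add: rat_eval_add rat_eval_mult p0)
    qed
    then obtain r where "p0 = f * r" by (auto elim: dvdE)
    moreover have "rat_eval f (u b) = 0" using f_root_iff by blast
    ultimately show ?thesis using p0[of "u b"] by (simp add: rat_eval_mult)
  qed
  then obtain \<sigma> where \<sigma>: "\<sigma> \<in> field_auts L" "\<sigma> (u 0) = u b"
    using conjugate_automorphism[OF f0 is_subfield_Rats Rats_subset_subfield[OF L] u_L u_alg, of 0 "u b"] by blast
  obtain a b' where *: "\<forall>j. \<sigma> (u j) = u (b' + a * j)" using sig_affine[OF \<sigma>(1)] by blast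
  then have "affine a b'" using \<sigma>(1) by (auto simp: affine_def)
  moreover have "int n dvd b' - b" using * \<sigma>(2) u_eq_iff[of b' b] by (metis add.right_neutral mult_zero_right)
  ultimately show ?thesis using affine_cong[of a b' a b] by auto
qed

lemma c_alg: "alg_over \<rat> (c 1)"
proof -
  define P where "P = lucas_V [:0, 1:] [:1:] n - ([:2:] :: complex poly)"
  have ev: "poly (lucas_V [:0, 1:] [:1:] k) x = lucas_V x 1 k" for k and x :: complex
    by (induction x "1::complex" k rule: lucas_V.induct) auto
  have ov: "poly_over \<rat> (lucas_V [:0, 1:] [:1:] k)" for k
    by (induction "[:0, 1::complex:]" "[:1::complex:]" k rule: lucas_V.induct)
      (auto intro!: poly_over_diff[OF is_subfield_Rats] poly_over_mult[OF is_subfield_Rats]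
        simp: poly_over_pCons[OF is_subfield_Rats] poly_over_0[OF is_subfield_Rats] numeral_poly simp del: mult_pCons_left)
  have V: "lucas_V (c 1) 1 n = 2"
    using lucas_V_sum[of "z 1" "z (-1)" n] by (simp add: z_minus_mult c_def)
  \<comment> \<open>The test point \<open>2 + 1/2\<close> is \<open>w + 1/w\<close> at
    \<open>w = 2\<close>, where \<open>P\<close> takes the positive value
    \<open>2^n + 2^(-n) - 2\<close>.\<close>
  have "P \<noteq> 0"
  proof
    assume "P = 0"
    then have "poly P (2 + 1 / 2) = 0" by simp
    then have "lucas_V (2 + 1 / 2) 1 n = (2 :: complex)" unfolding P_def by (simp only: poly_diff ev) simp
    then have eq: "2 ^ n + (1 / 2) ^ n = (2 :: complex)" using lucas_V_sum[of 2 "1 / 2 :: complex" n] by simp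
    have "2 ^ n + (1 / 2) ^ n = (2 :: real)"
      using arg_cong[OF eq, of Re] by (simp flip: of_real_power add: power_divide Re_power_real)
    moreover have "(2::real) ^ n \<ge> 2" using power_increasing[of 1 n "2::real"] n0 by simp
    moreover have "(1 / 2 :: real) ^ n > 0" by simp
    ultimately show False by linarith
  qed
  moreover have "poly_over \<rat> P" unfolding P_def
    by (intro poly_over_diff[OF is_subfield_Rats] ov) (simp add: poly_over_pCons[OF is_subfield_Rats] poly_over_0[OF is_subfield_Rats])
  moreover have "poly P (c 1) = 0" by (simp add: P_def ev V)
  ultimately show ?thesis unfolding alg_over_def by blast
qed

text \<open>The polynomial \<open>X + X^(n-1)\<close> takes the value \<open>c i\<close> at
  \<open>\<zeta>^i\<close>; substituting it carries the conjugacy of \<open>\<zeta>\<close> and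
  \<open>\<zeta>^m\<close> over to \<open>c 1\<close> and \<open>c k\<close>. An automorphism found
  this way is known only through \<open>c a = c k\<close>, which leaves the sign open.\<close>

lemma affine_unit_up_to_sign:
  assumes k: "coprime k (int n)"
  shows "\<exists>b. affine k b \<or> affine (- k) b"
proof -
  define m where "m = nat (k mod int n)"
  have m: "int m = k mod int n" using n0 by (simp add: m_def)
  have cop: "coprime m n" using k n0 m by (metis coprime_int_iff coprime_mod_left_iff of_nat_0_less_iff less_irrefl)
  have mk: "int n dvd int m - k" using m by (metis mod_eq_dvd_iff mod_mod_trivial)
  define X where "X = monom 1 1 + (monom 1 (n - 1) :: complex poly)"
  have X: "poly X (\<zeta> ^ i) = c (int i)" for i
  proof -
    have 1: "\<zeta> ^ i = z (int i)" by (simp add: z_def)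
    have "int n dvd int (n - 1) * int i - (- int i)" using n0 by (simp add: of_nat_diff algebra_simps)
    then have "z (int i) ^ (n - 1) = z (- int i)" by (simp only: z_pow z_eq_iff)
    then show ?thesis by (simp add: X_def 1 c_def poly_monom)
  qed
  have oX: "poly_over \<rat> X" unfolding X_def
    by (intro poly_over_add[OF is_subfield_Rats] poly_over_monom[OF is_subfield_Rats]) auto
  have "poly p (c k) = 0" if p: "poly_over \<rat> p" "poly p (c 1) = 0" for p
  proof -
    have "poly (pcompose p X) \<zeta> = 0" using X[of 1] p(2) by (simp add: poly_pcompose)
    then have "poly (pcompose p X) (\<zeta> ^ m) = 0"
      using rat_poly_root_unity[OF n0 cop zeta_pow_n poly_over_pcompose[OF is_subfield_Rats p(1) oX]] by blast
    then have "poly p (c (int m)) = 0" by (simp add: poly_pcompose X)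
    then show ?thesis using mk c_eq_iff by metis
  qed
  then obtain \<sigma> where \<sigma>: "\<sigma> \<in> field_auts L" "\<sigma> (c 1) = c k"
    using conjugate_automorphism[OF f0 is_subfield_Rats Rats_subset_subfield[OF L] c_L c_alg, of "c k"] by blast
  obtain a b where *: "\<forall>j. \<sigma> (u j) = u (b + a * j)" using sig_affine[OF \<sigma>(1)] by blast
  have "c a = c k" using sig_c[OF \<sigma>(1) *, of 1] \<sigma>(2) by simp
  then have "int n dvd a - k \<or> int n dvd a - (- k)" by (simp add: c_eq_iff)
  moreover have "affine a b" using * \<sigma>(1) by (auto simp: affine_def)
  ultimately show ?thesis using affine_cong[of a b _ b] by (metis dvd_0_right diff_self)
qed

section \<open>The elements \<open>e j\<close>, the translations and the multiplier -1\<close>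

lemma e_cong: "int n dvd i - j \<Longrightarrow> e i = e j"
  unfolding e_def by (metis z_eq_iff z_minus_mult(1) mult_left_cancel z_nz)

lemma e_uminus: "e (- j) = - e j"
  by (simp add: e_def algebra_simps)

lemma e_square: "e j ^ 2 = (c j ^ 2 - 4) * of_rat R"
proof -
  have "(z j - z (-j)) ^ 2 = (z j + z (-j)) ^ 2 - 4 * (z j * z (-j))" by (simp add: power2_eq_square algebra_simps)
  then show ?thesis by (simp add: e_def c_def power_mult_distrib rho2 z_minus_mult)
qed

text \<open>\<open>z q\<close> is a primitive cube root of unity, so \<open>c q = -1\<close> and
  \<open>(c q)^2 - 4 = -3\<close>.\<close>

lemma e_square_third:
  assumes "n = 3 * q"
  shows "e (int q) ^ 2 = - 3 * of_rat R"
proof -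
  define w where "w = z (int q)"
  have "q > 0" using assms n0 by simp
  then have w1: "w \<noteq> 1" using assms unfolding w_def z_eq_1_iff by (simp add: zdvd_not_zless)
  have "w ^ 3 = 1" using assms by (simp add: w_def z_pow z_eq_1_iff)
  moreover have "w ^ 3 - 1 = (w - 1) * (w ^ 2 + w + 1)" by (simp add: algebra_simps power2_eq_square power3_eq_cube)
  ultimately have w: "w ^ 2 + w + 1 = 0" using w1 by simp
  have "z (- int q) = w ^ 2" using assms unfolding w_def z_pow z_eq_iff by simp
  then have "c (int q) = -1" using w by (simp add: c_def w_def[symmetric] add_eq_0_iff add.commute)
  then show ?thesis by (simp add: e_square)
qed

text \<open>If it failed, commutators with one automorphism taking \<open>u 0\<close> to
  \<open>u 1\<close>, of multiplier \<open>a0\<close>, would give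
  \<open>1 - a = b * (1 - a0)\<close> modulo \<open>p\<close> for every group element.\<close>

lemma translation_not_multiple_of_prime:
  assumes p: "prime (p::int)" "p dvd int n" and e3: "\<And>q. n = 3 * q \<Longrightarrow> e (int q) \<notin> \<rat>"
  shows "\<exists>x. affine 1 x \<and> \<not> p dvd x"
proof (rule ccontr)
  assume "\<not> ?thesis"
  then have T: "\<And>x. affine 1 x \<Longrightarrow> p dvd x" by blast
  have cop: "\<not> p dvd a" if "affine a b" for a b
    using affine_coprime[OF that] p by (meson coprime_common_divisor not_prime_unit)
  obtain a0 where a0: "affine a0 1" using affine_transitive by blast
  have d: "p dvd (1 - a) - b * (1 - a0)" if "affine a b" for a b using T[OF affine_commutator[OF a0 that]] by simp
  have pa0: "p dvd 1 - a0"
  proof (rule ccontr)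
    \<comment> \<open>If \<open>1 - a0\<close> had an inverse \<open>y\<close> modulo
      \<open>p\<close>, an element with translation part \<open>y\<close> would have multiplier 0
      modulo \<open>p\<close>.\<close>
    assume "\<not> p dvd 1 - a0"
    then have "coprime p (1 - a0)" using p(1) by (simp add: prime_imp_coprime)
    then obtain x y where xy: "x * p + y * (1 - a0) = 1" by (metis bezout_int coprime_iff_gcd_eq_1)
    obtain a where a: "affine a y" using affine_transitive by blast
    have "a = x * p - ((1 - a) - y * (1 - a0))" using xy by simp
    then have "p dvd a" using d[OF a] by (metis dvd_diff dvd_triv_right)
    then show False using cop[OF a] by blast
  qed
  have one: "p dvd 1 - a" if "affine a b" for a b
    using dvd_add[OF d[OF that] dvd_mult[OF pa0, of b]] by simp
  have "coprime 2 (int n)" using odd_n by simp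
  then obtain b where "affine 2 b \<or> affine (- 2) b" using affine_unit_up_to_sign by blast
  then have "p dvd 1 - 2 \<or> p dvd 1 - (- 2)" using one by blast
  moreover have "\<not> p dvd 1 - 2" using p(1) by auto
  ultimately have "p dvd 3" by simp
  moreover have "prime (3::int)" by simp
  ultimately have p3: "p = 3" using p(1) primes_dvd_imp_eq by blast
  then obtain q where q: "n = 3 * q" using p(2) by (metis int_dvd_int_iff of_nat_numeral dvdE)
  have sq: "e (int q) ^ 2 \<in> \<rat>" unfolding e_square_third[OF q] by simp
  \<comment> \<open>\<open>e q\<close> is irrational with rational square, so some automorphism
    negates it; but its multiplier is 1 modulo 3, so \<open>a * q\<close> agrees with
    \<open>q\<close> modulo \<open>n\<close> and \<open>e q\<close> is fixed.\<close>
  obtain \<sigma> where \<sigma>: "\<sigma> \<in> field_auts L" "\<sigma> (e (int q)) = - e (int q)"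
    using conjugate_automorphism[OF f0 is_subfield_Rats Rats_subset_subfield[OF L] e_L alg_over_sqrt[OF is_subfield_Rats sq]
        conjugate_uminus[OF is_subfield_Rats e3[OF q] sq]] by blast
  obtain a b where *: "\<forall>j. \<sigma> (u j) = u (b + a * j)" using sig_affine[OF \<sigma>(1)] by blast
  then have "affine a b" using \<sigma>(1) by (auto simp: affine_def)
  then obtain y where "1 - a = 3 * y" using one[of a b] unfolding p3 by (auto elim: dvdE)
  then have a: "a = 1 - 3 * y" by simp
  have "a * int q - int q = int n * (- y)" unfolding a q by (simp add: algebra_simps)
  then have "e (a * int q) = e (int q)" by (intro e_cong) (metis dvd_triv_left)
  then have "e (int q) = - e (int q)" using sig_e[OF \<sigma>(1) *, of "int q"] \<sigma>(2) by simp
  then have "e (int q) = 0" by simp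
  then show False using e3[OF q] by simp
qed

text \<open>The translations are the multiples of the least positive one, \<open>m\<close>. As
  \<open>n\<close> is among them, a prime factor of \<open>m\<close> would divide \<open>n\<close>
  and every translation.\<close>

lemma affine_translation:
  assumes "\<And>q. n = 3 * q \<Longrightarrow> e (int q) \<notin> \<rat>"
  shows "affine 1 b"
proof -
  define P where "P = (\<lambda>k. k > 0 \<and> affine 1 (int k))"
  have Sn: "affine 1 (int n)" using affine_cong[OF affine_id, of 1 "int n"] by simp
  then have "P n" using n0 by (simp add: P_def)
  define m where "m = (LEAST k. P k)"
  have m: "P m" unfolding m_def using \<open>P n\<close> by (rule LeastI)
  have dvd: "int m dvd x" if "affine 1 x" for x
  proof -
    have "P (nat (gcd x (int m)))" using affine_translation_gcd[OF that] m by (auto simp: P_def)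
    then have "m \<le> nat (gcd x (int m))" unfolding m_def by (rule Least_le)
    moreover have "gcd x (int m) \<le> int m" using m by (intro gcd_le2_int) (simp add: P_def)
    ultimately have "gcd x (int m) = int m" by (simp add: le_nat_iff)
    then show ?thesis by (metis gcd_dvd1)
  qed
  have "m = 1"
  proof (rule ccontr)
    assume "m \<noteq> 1"
    then obtain p where p: "prime p" "p dvd m" using prime_factor_nat by blast
    then have "int p dvd int n" using dvd[OF Sn] by (meson dvd_trans int_dvd_int_iff)
    then obtain x where "affine 1 x" "\<not> int p dvd x"
      using translation_not_multiple_of_prime[of "int p"] p(1) assms by auto
    then show False using dvd p(2) by (meson dvd_trans int_dvd_int_iff)
  qed
  then show ?thesis using affine_translation_mult[of 1 b] m by (simp add: P_def)
qed

text \<open>\<open>e 1\<close> is a square root of an element of Q(c_1), so it has the conjugate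
  \<open>- e 1\<close> over that field. Fixing \<open>c 1\<close> leaves the multipliers 1 and -1,
  and 1 would fix \<open>e 1\<close>.\<close>

lemma affine_minus_1:
  assumes "e 1 \<notin> gen_field {c 1}"
  shows "\<exists>b. affine (-1) b"
proof -
  let ?K = "gen_field {c 1}"
  note K = is_subfield_gen_field[of "{c 1}"]
  have KL: "?K \<subseteq> L" using gen_field_least[OF L] c_L by auto
  have cK: "c 1 \<in> ?K" using gen_field_superset by auto
  have sq: "e 1 ^ 2 \<in> ?K" unfolding e_square
    using subfield_of_nat[OF K, of 4] by (intro subfield_mult[OF K] subfield_diff[OF K] subfield_power[OF K] cK subfield_of_rat[OF K]) simp
  obtain \<sigma> where \<sigma>: "\<sigma> \<in> field_auts L" "\<forall>x\<in>?K. \<sigma> x = x" "\<sigma> (e 1) = - e 1"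
    using conjugate_automorphism[OF f0 K KL e_L alg_over_sqrt[OF K sq] conjugate_uminus[OF K assms sq]] by blast
  obtain a b where *: "\<forall>j. \<sigma> (u j) = u (b + a * j)" using sig_affine[OF \<sigma>(1)] by blast
  have "c a = c 1" using sig_c[OF \<sigma>(1) *, of 1] \<sigma>(2) cK by simp
  then have "int n dvd a - 1 \<or> int n dvd a - (- 1)" by (simp add: c_eq_iff)
  moreover have "\<not> int n dvd a - 1"
  proof
    assume "int n dvd a - 1"
    then have "e a = e 1" by (rule e_cong)
    then have "e 1 = - e 1" using sig_e[OF \<sigma>(1) *, of 1] \<sigma>(3) by simp
    then have "e 1 = 0" by simp
    then show False using assms subfield_0[OF K] by simp
  qed
  moreover have "affine a b" using * \<sigma>(1) by (auto simp: affine_def)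
  ultimately show ?thesis using affine_cong[of a b "-1" b] by auto
qed

lemma not_affine_minus_1:
  assumes e: "e 1 \<in> gen_field {c 1}"
  shows "\<not> affine (-1) b"
proof
  assume "affine (-1) b"
  then obtain \<sigma> where \<sigma>: "\<sigma> \<in> field_auts L" "\<forall>j. \<sigma> (u j) = u (b + (-1) * j)" by (auto simp: affine_def)
  let ?F = "{x \<in> L. \<sigma> x = x}"
  note h = field_autsD(1)[OF \<sigma>(1)]
  have "is_subfield ?F"
    by (auto simp: is_subfield_def[of ?F] hom_on_0[OF L] hom_on_1[OF L] hom_on_add[OF L] hom_on_mult[OF L]
     hom_on_uminus[OF L] hom_on_inverse[OF L] subfield_0[OF L] subfield_1[OF L] subfield_add[OF L]
     subfield_mult[OF L] subfield_uminus[OF L] subfield_inverse[OF L] h)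
  moreover have "\<sigma> (c 1) = c 1" using sig_c[OF \<sigma>, of 1] by (simp add: c_def add.commute)
  ultimately have "gen_field {c 1} \<subseteq> ?F" using c_L by (intro gen_field_least) auto
  then have "\<sigma> (e 1) = e 1" using e by auto
  then have "e 1 = - e 1" using sig_e[OF \<sigma>, of 1] by (simp add: e_uminus)
  then have "z 1 = z (-1)" using rho0 by (simp add: e_def)
  then have "int n dvd 2" by (simp add: z_eq_iff)
  then have "int n \<le> 2" by (intro zdvd_imp_le) auto
  then show False using n3 by simp
qed

end

section \<open>The Galois group\<close>

lemma rat_square_int:
  fixes x :: rat
  assumes "x^2 = of_int k"
  shows "\<exists>m. x = of_int m"
proof -
  obtain a b where ab: "quotient_of x = (a, b)" by force
  have b: "b > 0" "coprime a b" "x = of_int a / of_int b"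
    using ab quotient_of_denom_pos quotient_of_coprime quotient_of_div by auto
  have "of_int (a^2) = (of_int (k * b^2) :: rat)"
    using assms b(1) by (simp add: b(3) power_divide field_simps)
  then have "a^2 = k * b^2" by (simp only: of_int_eq_iff)
  then have "b^2 dvd a^2" by simp
  then have "b dvd a" by simp
  then have "b = 1" using b(1,2) by (metis coprime_def dvd_refl zdvd1_eq abs_of_pos)
  then show ?thesis using b(3) by auto
qed

context de_moivre
begin

text \<open>Rationality would make \<open>-3 * R'\<close> a perfect square \<open>m^2\<close>; then
  \<open>m = 3 * y\<close> and \<open>R' = -3 * y^2\<close>, where square-freeness leaves only
  \<open>R' = -3\<close>.\<close>

lemma e_third_irrational:
  assumes R: "R = s^2 * of_int R'" "squarefree R'" and ne: "3 dvd n \<longrightarrow> R' \<noteq> -3" and q: "n = 3 * q"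
  shows "e (int q) \<notin> \<rat>"
proof
  assume "e (int q) \<in> \<rat>"
  then obtain r where r: "e (int q) = of_rat r" by (auto simp: Rats_def)
  have "complex_of_rat (r^2) = of_rat (- 3 * R)"
    using e_square_third[OF q] unfolding r by (simp add: of_rat_power of_rat_mult of_rat_minus)
  then have "r^2 = - 3 * R" by (simp only: of_rat_eq_iff)
  moreover have "s \<noteq> 0" using R(1) rho2 rho0 by auto
  ultimately have "(r / s)^2 = of_int (- 3 * R')" by (simp add: R(1) power_divide)
  then obtain m where m: "r / s = of_int m" using rat_square_int by blast
  have "of_int (m^2) = (of_int (- 3 * R') :: rat)" using \<open>(r / s)^2 = _\<close> unfolding m by simp
  then have m2: "m^2 = - 3 * R'" by (simp only: of_int_eq_iff)
  then have "3 dvd m^2" by simp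
  then have "3 dvd m" by (rule prime_dvd_power[rotated]) simp
  then obtain y where y: "m = 3 * y" by (auto elim: dvdE)
  have R': "R' = - 3 * y^2" using m2 y by (simp add: power_mult_distrib)
  then have "y^2 dvd R'" by simp
  then have "is_unit y" using R(2) squarefreeD by blast
  then have "y^2 = 1" by (auto simp: zdvd1_eq power2_eq_1_iff)
  then show False using R' ne q by simp
qed

text \<open>Conjugation separates the factors of \<open>e 1 = \<eta> * \<rho>\<close>:
  \<open>\<eta>\<close> is purely imaginary and Q(c_1) is real. If \<open>e 1\<close> lies there,
  \<open>\<rho>\<close> is imaginary, so \<open>R' < 0\<close>, and dividing by
  \<open>\<eta>\<close> and \<open>s\<close> gives the root \<open>w\<close>. Conversely, an
  imaginary \<open>w\<close> in Q(c_1)(\<eta>) has \<open>\<eta> * w\<close> in Q(c_1).\<close>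

lemma e_c_gen_iff:
  assumes R: "R = s^2 * of_int R'" and cnj: "cnj \<zeta> = inverse \<zeta>"
  shows "e 1 \<in> gen_field {c 1} \<longleftrightarrow> R' < 0 \<and> (\<exists>w\<in>gen_field {\<zeta>}. w^2 = of_int R')"
proof -
  let ?K = "gen_field {c 1}"
  note K = is_subfield_gen_field[of "{c 1}"]
  note Z = is_subfield_gen_field[of "{\<zeta>}"]
  define \<eta> where "\<eta> = z 1 - z (-1)"
  have z1: "z 1 = \<zeta>" "z (-1) = inverse \<zeta>" by (simp_all add: z_def power_int_minus)
  have e1: "e 1 = \<eta> * \<rho>" by (simp add: e_def \<eta>_def)
  have s0: "s \<noteq> 0" using R rho2 rho0 by auto
  have \<eta>0: "\<eta> \<noteq> 0"
  proof
    assume "\<eta> = 0"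
    then have "int n dvd 2" by (simp add: \<eta>_def z_eq_iff)
    then have "int n \<le> 2" by (intro zdvd_imp_le) auto
    then show False using n3 by simp
  qed
  have cnj\<eta>: "cnj \<eta> = - \<eta>" by (simp add: \<eta>_def z1 cnj complex_cnj_inverse)
  have cnjc: "cnj (c 1) = c 1" by (simp add: c_def z1 cnj complex_cnj_inverse add.commute)
  have "is_subfield \<real>" by (auto simp: is_subfield_def)
  then have KR: "?K \<subseteq> \<real>" using gen_field_least[of \<real> "{c 1}"] cnjc by (simp add: Reals_cnj_iff)
  have cK: "c 1 \<in> ?K" using gen_field_superset by auto
  have \<eta>2: "\<eta>^2 = c 1 ^ 2 - 4"
    using z_minus_mult(1)[of 1] by (simp add: \<eta>_def c_def power2_eq_square algebra_simps)
  have \<eta>2K: "\<eta>^2 \<in> ?K" unfolding \<eta>2 using subfield_of_nat[OF K, of 4]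
    by (intro subfield_diff[OF K] subfield_power[OF K] cK) simp
  have sR: "complex_of_rat R = of_rat s ^ 2 * of_int R'" by (simp add: R of_rat_mult of_rat_power)
  show ?thesis
  proof
    assume e: "e 1 \<in> ?K"
    then have "cnj (e 1) = e 1" using KR Reals_cnj_iff by blast
    then have "- (\<eta> * cnj \<rho>) = \<eta> * \<rho>" by (simp add: e1 cnj\<eta>)
    then have "\<eta> * (cnj \<rho> + \<rho>) = 0" by (simp add: distrib_left neg_eq_iff_add_eq_0)
    then have "cnj \<rho> = - \<rho>" using \<eta>0 by (simp add: eq_neg_iff_add_eq_0)
    then have "Re \<rho> = 0" by (simp add: complex_eq_iff)
    then have "Re (\<rho>^2) < 0" using rho0
      by (auto simp: power2_eq_square complex_eq_iff zero_less_mult_iff linorder_neq_iff)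
    moreover have "complex_of_real (of_rat s) = of_rat s" by (cases s) (simp add: of_rat_rat)
    then have "\<rho>^2 = of_real (of_rat s ^ 2 * of_int R')"
      unfolding rho2 sR by simp
    ultimately have "(of_rat s :: real) ^ 2 * of_int R' < 0" by simp
    then have neg: "R' < 0" by (metis mult_nonneg_nonneg not_less of_int_0_le_iff zero_le_power2)
    have \<zeta>Z: "\<zeta> \<in> gen_field {\<zeta>}" using gen_field_superset by auto
    have "c 1 \<in> gen_field {\<zeta>}" unfolding c_def z1 by (intro subfield_add[OF Z] subfield_inverse[OF Z] \<zeta>Z)
    then have "e 1 \<in> gen_field {\<zeta>}" using e gen_field_least[OF Z, of "{c 1}"] by auto
    moreover have "\<eta> \<in> gen_field {\<zeta>}" unfolding \<eta>_def z1 by (intro subfield_diff[OF Z] subfield_inverse[OF Z] \<zeta>Z)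
    ultimately have "e 1 / \<eta> / of_rat s \<in> gen_field {\<zeta>}" by (intro subfield_divide[OF Z] subfield_of_rat[OF Z])
    moreover have "(e 1 / \<eta> / of_rat s)^2 = of_int R'"
      using \<eta>0 s0 rho2 sR by (simp add: e1 power_divide)
    ultimately show "R' < 0 \<and> (\<exists>w\<in>gen_field {\<zeta>}. w^2 = of_int R')" using neg by blast
  next
    assume "R' < 0 \<and> (\<exists>w\<in>gen_field {\<zeta>}. w^2 = of_int R')"
    then obtain w where w: "R' < 0" "w \<in> gen_field {\<zeta>}" "w^2 = of_int R'" by blast
    let ?F = "{poly p \<eta> | p. poly_over ?K p}"
    have F: "is_subfield ?F" by (rule subfield_adjoin[OF K alg_over_sqrt[OF K \<eta>2K]])
    have "(c 1 + \<eta>) / of_rat 2 \<in> ?F"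
      using adjoin_superset[OF K, of \<eta>] cK by (intro subfield_divide[OF F] subfield_add[OF F] subfield_of_rat[OF F]) auto
    then have "\<zeta> \<in> ?F" by (simp add: c_def \<eta>_def z1)
    then have "w \<in> ?F" using gen_field_least[OF F, of "{\<zeta>}"] w(2) by blast
    then obtain p where p: "poly_over ?K p" "w = poly p \<eta>" by blast
    have cw: "cnj w = poly p (- \<eta>)"
      using poly_cnj_real[of p \<eta>] p KR cnj\<eta> by (auto simp: poly_over_def)
    \<comment> \<open>Conjugation replaces \<open>\<eta>\<close> by \<open>-\<eta>\<close>. The even
      and the odd part are treated together because multiplication by \<open>\<eta>\<close>
      exchanges them; \<open>\<eta>^2\<close> lies in Q(c_1).\<close>
    have "poly q \<eta> + poly q (- \<eta>) \<in> ?K \<and> \<eta> * (poly q \<eta> - poly q (- \<eta>)) \<in> ?K" if "poly_over ?K q" for q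
      using that
    proof (induction q)
      case 0
      then show ?case using subfield_0[OF K] by simp
    next
      case (pCons a q)
      then have *: "a \<in> ?K" "poly q \<eta> + poly q (- \<eta>) \<in> ?K" "\<eta> * (poly q \<eta> - poly q (- \<eta>)) \<in> ?K"
        by (auto simp: poly_over_pCons[OF K])
      have "poly (pCons a q) \<eta> + poly (pCons a q) (- \<eta>) = a + a + \<eta> * (poly q \<eta> - poly q (- \<eta>))"
        "\<eta> * (poly (pCons a q) \<eta> - poly (pCons a q) (- \<eta>)) = \<eta>^2 * (poly q \<eta> + poly q (- \<eta>))"
        by (simp_all add: algebra_simps power2_eq_square)
      then show ?case using * \<eta>2K by (simp only: subfield_add[OF K] subfield_mult[OF K] simp_thms)
    qed
    then have "\<eta> * (w - cnj w) \<in> ?K" using p cw by simp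
    moreover have "cnj w = - w"
    proof -
      have "cnj w ^ 2 = w ^ 2" using w(3) by (metis complex_cnj_of_int complex_cnj_power)
      moreover have "cnj w \<noteq> w"
      proof
        assume "cnj w = w"
        then obtain x where "w = of_real x" by (metis Reals_cnj_iff Reals_cases)
        then have "of_real (x^2) = (of_real (of_int R') :: complex)" using w(3) by simp
        then have "x^2 = of_int R'" by (simp only: of_real_eq_iff)
        then have "0 \<le> (of_int R' :: real)" by (metis zero_le_power2)
        then show False using w(1) by simp
      qed
      ultimately show ?thesis by (simp add: power2_eq_iff)
    qed
    ultimately have "\<eta> * (w + w) \<in> ?K" by simp
    \<comment> \<open>The factor 1/2 undoes \<open>w + w\<close>, and \<open>s\<close> turns
      \<open>w\<close> into a square root of \<open>R\<close>.\<close>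
    then have "of_rat (s / 2) * (\<eta> * (w + w)) \<in> ?K" by (rule subfield_mult[OF K subfield_of_rat[OF K]])
    then have K1: "\<eta> * (of_rat s * w) \<in> ?K" by (simp add: of_rat_divide mult_ac)
    have "\<rho>^2 = (of_rat s * w)^2" unfolding rho2 sR by (simp add: power_mult_distrib w(3))
    then have "\<rho> = of_rat s * w \<or> \<rho> = - (of_rat s * w)" by (simp add: power2_eq_iff)
    then show "e 1 \<in> ?K" using K1 subfield_uminus[OF K K1] by (auto simp: e1)
  qed
qed

text \<open>The maps with \<open>b = 0\<close> form the stabiliser of \<open>u 0\<close>, which acts
  on the translations by multiplication. The bijection \<open>\<pi>\<close> renames it as
  \<open>Q\<close>, so that one proof serves both the unit group and its quotient by 1 and
  -1.\<close>

lemma iso_semidirect_stabilizer: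
  fixes Q :: "('h, 'b) monoid_scheme"
  assumes T: "\<And>b. affine 1 b"
    and bij: "bij_betw \<pi> {a \<in> {0..<int n}. affine a 0} (carrier Q)"
    and mult: "\<And>a a'. a \<in> {0..<int n} \<Longrightarrow> affine a 0 \<Longrightarrow> a' \<in> {0..<int n} \<Longrightarrow> affine a' 0 \<Longrightarrow>
      \<pi> (a * a' mod int n) = \<pi> a \<otimes>\<^bsub>Q\<^esub> \<pi> a'"
  shows "iso_semidirect (Gal L) (integer_mod_group n) Q"
proof -
  define H where "H = {a \<in> {0..<int n}. affine a 0}"
  have n: "int n > 0" using n0 by simp
  \<comment> \<open>With all translations present, whether a multiplier occurs does not depend on
    \<open>b\<close>.\<close>
  have S0: "affine a 0" if "affine a b" for a b
    using affine_translation_add[OF T[of "-b"] that] by simp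
  have Sb: "affine a b" if "affine a 0" for a b
    using affine_translation_add[OF T[of b] that] by simp
  have Hmult: "a * a' mod int n \<in> H" if "a \<in> H" "a' \<in> H" for a a'
  proof -
    have "affine (a * a') 0" using affine_mult[of a 0 a' 0] that by (simp add: H_def)
    then have "affine (a * a' mod int n) 0" by (rule affine_cong) (simp_all add: mod_eq_dvd_iff[symmetric])
    then show ?thesis using n by (simp add: H_def)
  qed
  define g where "g = inv_into H \<pi>"
  have \<pi>: "bij_betw \<pi> H (carrier Q)" using bij by (simp add: H_def)
  have g: "g q \<in> H" "\<pi> (g q) = q" if "q \<in> carrier Q" for q
    using that \<pi> unfolding g_def bij_betw_def by (auto intro: inv_into_into f_inv_into_f)
  have g\<pi>: "g (\<pi> a) = a" if "a \<in> H" for a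
    using that \<pi> by (simp add: g_def bij_betw_def)
  have gmult: "g (q \<otimes>\<^bsub>Q\<^esub> q') = g q * g q' mod int n" if "q \<in> carrier Q" "q' \<in> carrier Q" for q q'
    using g\<pi>[OF Hmult[OF g(1) g(1)]] mult g that by (simp add: H_def)
  define \<phi> where "\<phi> = (\<lambda>q b. g q * b mod int n)"
  define N where "N = integer_mod_group n"
  have N: "carrier N = {0..<int n}" "\<And>x y. x \<otimes>\<^bsub>N\<^esub> y = (x + y) mod int n"
    using n0 by (simp_all add: N_def integer_mod_group_def)
  have action: "aut_action N Q \<phi>"
    unfolding aut_action_def
  proof (intro conjI ballI)
    fix q assume q: "q \<in> carrier Q"
    have cop: "coprime (g q) (int n)" using g(1)[OF q] affine_coprime by (auto simp: H_def)
    have inj: "inj_on (\<phi> q) {0..<int n}"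
    proof (rule inj_onI)
      fix x y assume xy: "x \<in> {0..<int n}" "y \<in> {0..<int n}" "\<phi> q x = \<phi> q y"
      then have "[g q * x = g q * y] (mod int n)" by (simp add: \<phi>_def cong_def)
      then have "[x = y] (mod int n)" using cop by (simp add: cong_mult_lcancel)
      then show "x = y" using xy by (simp add: cong_def)
    qed
    moreover have "\<phi> q ` {0..<int n} \<subseteq> {0..<int n}" using n by (auto simp: \<phi>_def)
    ultimately have "bij_betw (\<phi> q) {0..<int n} {0..<int n}"
      by (simp add: bij_betw_def endo_inj_surj)
    moreover have "\<phi> q ((x + y) mod int n) = (\<phi> q x + \<phi> q y) mod int n" for x y
      by (simp add: \<phi>_def mod_simps distrib_left)
    ultimately show "\<phi> q \<in> iso N N"
      using n by (auto simp: iso_def hom_def N \<phi>_def)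
  next
    fix q q' a assume "q \<in> carrier Q" "q' \<in> carrier Q" "a \<in> carrier N"
    then show "\<phi> (q \<otimes>\<^bsub>Q\<^esub> q') a = \<phi> q (\<phi> q' a)"
      by (simp add: \<phi>_def gmult mod_simps mult.assoc)
  qed
  have "\<exists>a b. a \<in> {0..<int n} \<and> b \<in> {0..<int n} \<and> (\<forall>j. \<sigma> (u j) = u (b + a * j))"
    if \<sigma>: "\<sigma> \<in> field_auts L" for \<sigma>
  proof -
    obtain a b where ab: "\<forall>j. \<sigma> (u j) = u (b + a * j)" using sig_affine[OF \<sigma>] by blast
    have "\<forall>j. u (b + a * j) = u (b mod int n + a mod int n * j)"
      unfolding affine_cong_iff by (simp add: mod_eq_dvd_iff[symmetric])
    then show ?thesis using ab n by (intro exI[of _ "a mod int n"] exI[of _ "b mod int n"]) simp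
  qed
  \<comment> \<open>Restricting both residues to \<open>0..<int n\<close> makes the affine
    description of an automorphism unique.\<close>
  then obtain A B where AB: "\<And>\<sigma>. \<sigma> \<in> field_auts L \<Longrightarrow>
      A \<sigma> \<in> {0..<int n} \<and> B \<sigma> \<in> {0..<int n} \<and> (\<forall>j. \<sigma> (u j) = u (B \<sigma> + A \<sigma> * j))"
    by metis
  have uniq: "A \<sigma> = a \<and> B \<sigma> = b" if "\<sigma> \<in> field_auts L" "a \<in> {0..<int n}" "b \<in> {0..<int n}"
      "\<forall>j. \<sigma> (u j) = u (b + a * j)" for \<sigma> a b
  proof -
    have "\<forall>j. u (B \<sigma> + A \<sigma> * j) = u (b + a * j)" using AB[OF that(1)] that(4) by simp
    then have "int n dvd B \<sigma> - b" "int n dvd A \<sigma> - a" by (simp_all add: affine_cong_iff)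
    then show ?thesis using AB[OF that(1)] that(2,3) by (simp add: mod_eq_dvd_iff[symmetric])
  qed
  have AH: "A \<sigma> \<in> H" if "\<sigma> \<in> field_auts L" for \<sigma>
    using AB[OF that] that S0[of "A \<sigma>" "B \<sigma>"] by (auto simp: H_def affine_def)
  define h where "h = (\<lambda>\<sigma>. (B \<sigma>, \<pi> (A \<sigma>)))"
  define P where "P = semidirect_product N Q \<phi>"
  have \<pi>A: "\<pi> (A \<sigma>) \<in> carrier Q" if "\<sigma> \<in> field_auts L" for \<sigma>
    using AH[OF that] \<pi> by (auto simp: bij_betw_def)
  have "h \<in> hom (Gal L) P"
  proof (rule homI)
    fix \<sigma> assume "\<sigma> \<in> carrier (Gal L)"
    then show "h \<sigma> \<in> carrier P" using AB \<pi>A by (simp add: Gal_def h_def P_def semidirect_product_def N)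
  next
    fix \<sigma> \<tau> assume "\<sigma> \<in> carrier (Gal L)" "\<tau> \<in> carrier (Gal L)"
    then have st: "\<sigma> \<in> field_auts L" "\<tau> \<in> field_auts L" by (simp_all add: Gal_def)
    have "(\<sigma> \<circ> \<tau>) (u j) = u ((B \<sigma> + A \<sigma> * B \<tau>) + (A \<sigma> * A \<tau>) * j)" for j
      using AB[OF st(1)] AB[OF st(2)] by (simp add: algebra_simps)
    moreover have "\<forall>j. u ((B \<sigma> + A \<sigma> * B \<tau>) + (A \<sigma> * A \<tau>) * j)
        = u ((B \<sigma> + A \<sigma> * B \<tau>) mod int n + (A \<sigma> * A \<tau> mod int n) * j)"
      unfolding affine_cong_iff by (simp add: mod_eq_dvd_iff[symmetric])
    ultimately have "A (\<sigma> \<circ> \<tau>) = A \<sigma> * A \<tau> mod int n \<and> B (\<sigma> \<circ> \<tau>) = (B \<sigma> + A \<sigma> * B \<tau>) mod int n"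
      by (intro uniq field_auts_comp st) (use n in simp_all)
    moreover have "\<pi> (A \<sigma> * A \<tau> mod int n) = \<pi> (A \<sigma>) \<otimes>\<^bsub>Q\<^esub> \<pi> (A \<tau>)"
      using AH[OF st(1)] AH[OF st(2)] mult by (simp add: H_def)
    ultimately show "h (\<sigma> \<otimes>\<^bsub>Gal L\<^esub> \<tau>) = h \<sigma> \<otimes>\<^bsub>P\<^esub> h \<tau>"
      using g\<pi>[OF AH[OF st(1)]]
      by (simp add: Gal_def h_def P_def semidirect_product_def N \<phi>_def mod_simps)
  qed
  moreover have "bij_betw h (carrier (Gal L)) (carrier P)"
    unfolding bij_betw_def
  proof
    show "inj_on h (carrier (Gal L))"
    proof (rule inj_onI)
      fix \<sigma> \<tau> assume "\<sigma> \<in> carrier (Gal L)" "\<tau> \<in> carrier (Gal L)" and h: "h \<sigma> = h \<tau>"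
      then have st: "\<sigma> \<in> field_auts L" "\<tau> \<in> field_auts L" by (simp_all add: Gal_def)
      have "B \<sigma> = B \<tau>" "\<pi> (A \<sigma>) = \<pi> (A \<tau>)" using h by (simp_all add: h_def)
      moreover from this(2) have "A \<sigma> = A \<tau>"
        using g\<pi>[OF AH[OF st(1)]] g\<pi>[OF AH[OF st(2)]] by metis
      ultimately have "\<sigma> (u j) = \<tau> (u j)" for j using AB[OF st(1)] AB[OF st(2)] by metis
      then show "\<sigma> = \<tau>" by (rule aut_eqI[OF st])
    qed
    show "h ` carrier (Gal L) = carrier P"
    proof
      show "h ` carrier (Gal L) \<subseteq> carrier P" using \<open>h \<in> hom (Gal L) P\<close> by (auto simp: hom_def)
      show "carrier P \<subseteq> h ` carrier (Gal L)"
      proof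
        fix x assume "x \<in> carrier P"
        then obtain b q where x: "x = (b, q)" "b \<in> {0..<int n}" "q \<in> carrier Q"
          by (auto simp: P_def semidirect_product_def N)
        have gq: "g q \<in> {0..<int n}" "affine (g q) b" using g(1)[OF x(3)] Sb by (auto simp: H_def)
        then obtain \<sigma> where \<sigma>: "\<sigma> \<in> field_auts L" "\<forall>j. \<sigma> (u j) = u (b + g q * j)" by (auto simp: affine_def)
        have "A \<sigma> = g q \<and> B \<sigma> = b" by (rule uniq[OF \<sigma>(1) gq(1) x(2) \<sigma>(2)])
        then have "h \<sigma> = x" using g(2)[OF x(3)] x(1) by (simp add: h_def)
        then show "x \<in> h ` carrier (Gal L)" using \<sigma>(1) by (auto simp: Gal_def)
      qed
    qed
  qed
  ultimately have "Gal L \<cong> P" by (auto simp: is_iso_def iso_def)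
  then show ?thesis using action unfolding iso_semidirect_def P_def N_def by blast
qed

section \<open>The stabiliser as a group of units\<close>

lemma units_mod_simps:
  "carrier (units_mod n) = {a \<in> {0..<int n}. coprime a (int n)}"
  "x \<otimes>\<^bsub>units_mod n\<^esub> y = x * y mod int n"
  "\<one>\<^bsub>units_mod n\<^esub> = 1"
  "comm_group (units_mod n)"
proof -
  interpret residues "int n" "residue_ring (int n)" using n3 by unfold_locales auto
  have "coprime 0 (int n) \<longleftrightarrow> False" using n3 by simp
  then have "\<And>a. coprime a (int n) \<Longrightarrow> a \<noteq> 0" by auto
  then show "carrier (units_mod n) = {a \<in> {0..<int n}. coprime a (int n)}"
    by (auto simp: units_mod_def units_of_carrier res_units_eq le_less)
  show "x \<otimes>\<^bsub>units_mod n\<^esub> y = x * y mod int n"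
    by (simp add: units_mod_def units_of_mult residue_ring_def)
  show "\<one>\<^bsub>units_mod n\<^esub> = 1" by (simp add: units_mod_def units_of_one residue_ring_def)
  show "comm_group (units_mod n)" unfolding units_mod_def by (rule units_comm_group)
qed

lemma affine_of_minus_1:
  assumes T: "\<And>b. affine 1 b" and k: "coprime k (int n)" and m: "affine (-1) 0"
  shows "affine k 0"
proof -
  obtain b where "affine k b \<or> affine (- k) b" using affine_unit_up_to_sign[OF k] by blast
  then have "affine k b \<or> affine k (- b)" using affine_mult[OF m, of "- k" b] by auto
  then obtain b' where "affine k b'" by blast
  then show ?thesis using affine_translation_add[OF T[of "- b'"]] by fastforce
qed

lemma iso_units_mod:
  assumes T: "\<And>b. affine 1 b" and m: "affine (-1) 0"
  shows "iso_semidirect (Gal L) (integer_mod_group n) (units_mod n)"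
proof (rule iso_semidirect_stabilizer[OF T, of "\<lambda>a. a"])
  have "{a \<in> {0..<int n}. affine a 0} = carrier (units_mod n)"
    using affine_of_minus_1[OF T _ m] affine_coprime by (auto simp: units_mod_simps)
  then show "bij_betw (\<lambda>a. a) {a \<in> {0..<int n}. affine a 0} (carrier (units_mod n))" by (simp add: bij_betw_def)
qed (simp add: units_mod_simps)

text \<open>The stabiliser meets every class of units up to sign, by
  \<open>affine_unit_up_to_sign\<close>, and in one element only, since \<open>a\<close> and
  \<open>-a\<close> together would produce -1. So it represents the cosets of 1 and -1.\<close>

lemma iso_units_mod_pm:
  assumes T: "\<And>b. affine 1 b" and m: "\<not> affine (-1) 0"
  shows "iso_semidirect (Gal L) (integer_mod_group n) (units_mod_pm n)"
proof -
  let ?U = "units_mod n" and ?N = "{1, int n - 1}"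
  interpret U: comm_group ?U by (rule units_mod_simps)
  have n: "int n \<ge> 3" using n3 by simp
  have neg: "(int n - 1) * a mod int n = (- a) mod int n" for a
    by (simp add: mod_eq_dvd_iff algebra_simps)
  have cop: "coprime (int n - 1) (int n)"
    by (metis coprime_diff_one_left)
  have sq: "(int n - 1) * (int n - 1) mod int n = 1" using n by (simp add: neg mod_eq_dvd_iff zmod_zminus1_eq_if) 
  have inv: "inv\<^bsub>?U\<^esub> (int n - 1) = int n - 1"
    by (rule U.inv_equality) (use n cop sq in \<open>auto simp: units_mod_simps\<close>)
  have sub: "subgroup ?N ?U"
    by (rule U.subgroupI) (use n cop inv sq U.inv_one in \<open>auto simp: units_mod_simps zmod_minus1\<close>)
  interpret N: normal ?N ?U by (rule U.subgroup_imp_normal[OF sub])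
  have coset: "?N #>\<^bsub>?U\<^esub> a = {a, (- a) mod int n}" if "a \<in> {0..<int n}" for a
    using that by (auto simp: r_coset_def units_mod_simps neg)
  have HU: "a \<in> carrier ?U" if "a \<in> {0..<int n}" "affine a 0" for a
    using that affine_coprime by (auto simp: units_mod_simps)
  show ?thesis
  proof (rule iso_semidirect_stabilizer[OF T, of "\<lambda>a. ?N #>\<^bsub>?U\<^esub> a"])
    fix a a' assume *: "a \<in> {0..<int n}" "affine a 0" "a' \<in> {0..<int n}" "affine a' 0"
    show "?N #>\<^bsub>?U\<^esub> (a * a' mod int n) = (?N #>\<^bsub>?U\<^esub> a) \<otimes>\<^bsub>units_mod_pm n\<^esub> (?N #>\<^bsub>?U\<^esub> a')"
      using N.rcos_sum[OF HU[OF *(1,2)] HU[OF *(3,4)]]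
      by (simp add: units_mod_pm_def FactGroup_def units_mod_simps)
  next
    show "bij_betw (\<lambda>a. ?N #>\<^bsub>?U\<^esub> a) {a \<in> {0..<int n}. affine a 0} (carrier (units_mod_pm n))"
      unfolding bij_betw_def
    proof
      show "inj_on (\<lambda>a. ?N #>\<^bsub>?U\<^esub> a) {a \<in> {0..<int n}. affine a 0}"
      proof (rule inj_onI)
        fix a a' assume "a \<in> {a \<in> {0..<int n}. affine a 0}" "a' \<in> {a \<in> {0..<int n}. affine a 0}"
          and eq: "?N #>\<^bsub>?U\<^esub> a = ?N #>\<^bsub>?U\<^esub> a'"
        then have *: "a \<in> {0..<int n}" "affine a 0" "a' \<in> {0..<int n}" "affine a' 0" by auto
        have "a = a' \<or> a = (- a') mod int n" using eq unfolding coset[OF *(1)] coset[OF *(3)] by blast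
        moreover have False if "a = (- a') mod int n"
        proof -
          have "int n dvd a - (- a')" unfolding that mod_eq_dvd_iff[symmetric] by simp
          then have na: "affine (- a') 0" using affine_cong[OF *(2)] by simp
          \<comment> \<open>Composing the map for \<open>- a'\<close> with an inverse of the one for
            \<open>a'\<close> produces the multiplier -1.\<close>
          obtain x y where xy: "affine x y" "int n dvd a' * x - 1" using affine_inverse[OF *(4)] by blast
          have "int n dvd - a' * x - (- 1)" using xy(2) by (metis add_uminus_conv_diff dvd_minus_iff minus_add_distrib minus_mult_left)
          then have "affine (- 1) (- a' * y)" using affine_cong[OF affine_mult[OF na xy(1)], of "-1" "- a' * y"] by simp
          then have "affine (- 1) 0" using affine_translation_add[OF T[of "a' * y"]] by fastforce
          then show False using m by blast
        qed
        ultimately show "a = a'" by blast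
      qed
      show "(\<lambda>a. ?N #>\<^bsub>?U\<^esub> a) ` {a \<in> {0..<int n}. affine a 0} = carrier (units_mod_pm n)"
      proof
        show "(\<lambda>a. ?N #>\<^bsub>?U\<^esub> a) ` {a \<in> {0..<int n}. affine a 0} \<subseteq> carrier (units_mod_pm n)"
          using HU by (auto simp: units_mod_pm_def FactGroup_def RCOSETS_def)
        show "carrier (units_mod_pm n) \<subseteq> (\<lambda>a. ?N #>\<^bsub>?U\<^esub> a) ` {a \<in> {0..<int n}. affine a 0}"
        proof
          fix C assume "C \<in> carrier (units_mod_pm n)"
          then obtain k where k: "k \<in> carrier ?U" "C = ?N #>\<^bsub>?U\<^esub> k"
            by (auto simp: units_mod_pm_def FactGroup_def RCOSETS_def)
          then have kk: "k \<in> {0..<int n}" "coprime k (int n)" by (auto simp: units_mod_simps)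
          obtain b where "affine k b \<or> affine (- k) b" using affine_unit_up_to_sign[OF kk(2)] by blast
          then have "affine k 0 \<or> affine (- k) 0" using affine_translation_add[OF T[of "- b"], of _ b] by auto
          then show "C \<in> (\<lambda>a. ?N #>\<^bsub>?U\<^esub> a) ` {a \<in> {0..<int n}. affine a 0}"
          proof
            assume "affine k 0"
            then show ?thesis using k kk by blast
          next
            assume k': "affine (- k) 0"
            define a where "a = (- k) mod int n"
            have a: "a \<in> {0..<int n}" using n by (simp add: a_def)
            have "affine a 0" using k' by (rule affine_cong) (simp_all add: a_def mod_eq_dvd_iff[symmetric])
            moreover have "?N #>\<^bsub>?U\<^esub> a = C"
              unfolding k(2) coset[OF a] coset[OF kk(1)] using kk(1) by (auto simp: a_def mod_minus_eq)
            ultimately show ?thesis using a by blast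
          qed
        qed
      qed
    qed
  qed
qed

end

theorem theorem1:
  fixes n :: nat and d R s :: rat and R' :: int
  assumes "n \<ge> 3" and "odd n"
    and "d \<noteq> 0"
    and "\<not> (\<exists>q::rat. R = q^2)"
    and "R = s^2 * of_int R'" and "squarefree R'"
    and "irreducible (de_moivre_poly n d R)"
    and "3 dvd n \<longrightarrow> R' \<noteq> -3"
  shows "if R' < 0 \<and> (\<exists>w \<in> gen_field {exp (2 * pi * \<i> / of_nat n)}. w^2 = of_int R')
         then iso_semidirect (Gal (splitting_field (de_moivre_poly n d R)))
                (integer_mod_group n) (units_mod_pm n)
         else iso_semidirect (Gal (splitting_field (de_moivre_poly n d R)))
                (integer_mod_group n) (units_mod n)"
proof -
  have n0: "n > 0" using assms(1) by simp
  define \<zeta> :: complex where "\<zeta> = exp (2 * pi * \<i> / of_nat n)"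
  have \<zeta>cis: "\<zeta> = cis (2 * pi / n)" by (simp add: \<zeta>_def cis_conv_exp mult_ac)
  have pow: "\<zeta> ^ k = cis (2 * pi * real k / real n)" for k
    by (simp add: \<zeta>cis Complex.DeMoivre mult_ac)
  have \<zeta>n: "\<zeta> ^ n = 1" using n0 by (simp add: pow)
  have \<zeta>0: "\<zeta> \<noteq> 0" by (simp add: \<zeta>cis)
  have roots: "bij_betw (\<lambda>k. \<zeta> ^ k) {..<n} {w. w ^ n = 1}"
    using bij_betw_roots_unity[OF n0] by (simp only: pow)
  define D where "D = d^2 - R"
  define m where "m = (n - 1) div 2"
  define \<rho> where "\<rho> = csqrt (of_rat R)"
  define \<alpha> where "\<alpha> = of_rat D ^ m * (of_rat d + \<rho>)"
  have \<rho>2: "\<rho>^2 = of_rat R" by (simp add: \<rho>_def)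
  \<comment> \<open>\<open>R = 0\<close> and \<open>D = 0\<close> would make \<open>R\<close> the
    square of 0 or of \<open>d\<close>.\<close>
  have R0: "R \<noteq> 0" using assms(4) by (metis power_zero_numeral)
  have D0: "D \<noteq> 0" using assms(4) by (auto simp: D_def)
  have nm: "n = Suc (2 * m)" using assms(2) by (auto simp: m_def elim: oddE)
  have D\<rho>: "(of_rat d + \<rho>) * (of_rat d - \<rho>) = of_rat D"
    by (simp add: D_def of_rat_diff of_rat_mult \<rho>2[symmetric] power2_eq_square algebra_simps)
  have prod: "\<alpha> * (of_rat D ^ m * (of_rat d - \<rho>)) = of_rat D ^ n"
  proof -
    have "\<alpha> * (of_rat D ^ m * (of_rat d - \<rho>)) = of_rat D ^ m * of_rat D ^ m * ((of_rat d + \<rho>) * (of_rat d - \<rho>))"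
      by (simp add: \<alpha>_def)
    then show ?thesis unfolding D\<rho> by (simp add: nm power_add[symmetric] mult_2 del: of_rat_power)
  qed
  have \<alpha>0: "\<alpha> \<noteq> 0" using prod D0 by (metis mult_zero_left of_rat_eq_0_iff power_eq_0_iff)
  define t where "t = rcis (root n (cmod \<alpha>)) (Arg \<alpha> / n)"
  define t' where "t' = of_rat D / t"
  have tn: "t ^ n = \<alpha>" using n0 by (simp add: t_def DeMoivre2 rcis_cmod_Arg)
  then have t0: "t \<noteq> 0" using \<alpha>0 n0 by auto
  interpret de_moivre n d R \<zeta> t t' \<rho>
  proof
    show "n \<ge> 3" "odd n" "d \<noteq> 0" "irreducible (de_moivre_poly n d R)" by fact+
    show "\<rho>\<^sup>2 = of_rat R" by fact
    then show "\<rho> \<noteq> 0" using R0 by auto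
    show "d\<^sup>2 - R \<noteq> 0" using D0 by (simp add: D_def)
    show "t * t' = of_rat (d\<^sup>2 - R)" using t0 by (simp add: t'_def D_def)
    show "t ^ n = of_rat (d\<^sup>2 - R) ^ ((n - 1) div 2) * (of_rat d + \<rho>)"
      using tn by (simp only: \<alpha>_def D_def m_def)
    have "t' ^ n = of_rat D ^ n / \<alpha>" by (simp add: t'_def power_divide tn)
    then have "t' ^ n = of_rat D ^ m * (of_rat d - \<rho>)" using prod \<alpha>0 by (metis nonzero_mult_div_cancel_left)
    then show "t' ^ n = of_rat (d\<^sup>2 - R) ^ ((n - 1) div 2) * (of_rat d - \<rho>)"
      by (simp only: D_def m_def)
    show "\<exists>k. w = \<zeta> powi k" if "w ^ n = 1" for w
    proof -
      have "w \<in> (\<lambda>k. \<zeta> ^ k) ` {..<n}" using that bij_betw_imp_surj_on[OF roots] by simp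
      then obtain k where "w = \<zeta> ^ k" by blast
      then show ?thesis by (intro exI[of _ "int k"]) simp
    qed
    show "\<zeta> powi k = 1 \<longleftrightarrow> int n dvd k" for k
    proof -
      define r where "r = nat (k mod int n)"
      have r: "int r = k mod int n" "r < n" using n0 by (auto simp: r_def nat_less_iff)
      have "\<zeta> powi k = \<zeta> powi (int n * (k div int n) + k mod int n)" by simp
      also have "\<dots> = (\<zeta> powi int n) powi (k div int n) * \<zeta> powi int r"
        using \<zeta>0 unfolding r(1) by (simp only: power_int_add power_int_mult simp_thms)
      also have "\<dots> = \<zeta> ^ r" by (simp add: \<zeta>n)
      finally have "\<zeta> powi k = 1 \<longleftrightarrow> \<zeta> ^ r = \<zeta> ^ 0" by simp
      also have "\<dots> \<longleftrightarrow> r = 0"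
        by (rule inj_on_eq_iff[OF bij_betw_imp_inj_on[OF roots]]) (use r(2) n0 in auto)
      finally show ?thesis using r(1) by (auto simp: dvd_eq_mod_eq_0)
    qed
  qed
  have T: "affine 1 b" for b
    by (rule affine_translation) (rule e_third_irrational[OF assms(5,6,8)])
  have cnj: "cnj \<zeta> = inverse \<zeta>" by (simp add: \<zeta>cis cis_cnj)
  \<comment> \<open>\<open>T\<close> brings any translation part to 0, so the multiplier -1 occurs
    for some \<open>b\<close> exactly when it occurs in the stabiliser.\<close>
  have exc: "R' < 0 \<and> (\<exists>w\<in>gen_field {\<zeta>}. w^2 = of_int R') \<longleftrightarrow> \<not> affine (-1) 0"
    using e_c_gen_iff[OF assms(5) cnj] affine_minus_1 not_affine_minus_1 affine_translation_add[OF T, of "-1"] by (metis add.left_inverse)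
  show ?thesis
    using exc iso_units_mod[OF T] iso_units_mod_pm[OF T] unfolding \<zeta>_def by auto
qed

end
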